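(* Let $n,m\ge 1$, $\mathcal{Z}=\Delta_n\times\Delta_m$, and let $f:\Delta_n\times\Delta_m\to\mathbb{R}$ be differentiable, convex in its first argument and concave in its second, with nonempty set of saddle points and with saddle operator $G$ that is $L$-Lipschitz on $\mathcal{Z}$. Let $(z_t,z'_t)_{t\ge 0}$ be generated by OMWU with $0<\eta<\frac{1}{3L}$ and initialization $z_0,z'_0\in\operatorname{ri}\mathcal{Z}$. Let $\bar z=(\bar x,\bar y)$ be any cluster point of $(z_t)$, let $S_{\bar x}=\operatorname{supp}(\bar x)$ and $S_{\bar y}=\operatorname{supp}(\bar y)$, and let $a_{\bar x},a_{\bar y}\in\mathbb{R}$ be the active-face constants of $\bar z$, i.e. the scalars with $\frac{\partial f(\bar x,\bar y)}{\partial x_i}=a_{\bar x}$ for all $i\in S_{\bar x}$ and $-\frac{\partial f(\bar x,\bar y)}{\partial y_j}=a_{\bar y}$ for all $j\in S_{\bar y}$ (such scalars exist for every cluster point). Then $$\frac{\partial f(\bar x,\bar y)}{\partial x_i}\ge a_{\bar x}\quad\forall i\notin S_{\bar x},\qquad\text{and}\qquad -\frac{\partial f(\bar x,\bar y)}{\partial y_j}\ge a_{\bar y}\quad\forall j\notin S_{\bar y}.$$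
   Context: $\Delta_d=\{p\in\mathbb{R}^d_{\ge 0}:\sum_{i=1}^d p_i=1\}$, and $\operatorname{ri}$ denotes relative interior (so $\operatorname{ri}\mathcal{Z}$ is the set of points of $\mathcal Z$ with all coordinates strictly positive). $\operatorname{supp}(p)=\{i:p_i>0\}$. Points of $\mathcal{Z}=\Delta_n\times\Delta_m$ are written $z=(x,y)$. Saddle points: $z^\star=(x^\star,y^\star)\in\mathcal{Z}$ is a saddle point if $f(x^\star,y)\le f(x^\star,y^\star)\le f(x,y^\star)$ for all $(x,y)\in\mathcal{Z}$. Saddle operator: $G(z)=(\nabla_x f(x,y),-\nabla_y f(x,y))$. The norm is $\|z\|=\sqrt{\|x\|_1^2+\|y\|_1^2}$, with dual norm $\|(a,b)\|_\star=\sqrt{\|a\|_\infty^2+\|b\|_\infty^2}$. "$G$ is $L$-Lipschitz" means $\|G(z)-G(w)\|_\star\le L\|z-w\|$ for all $z,w\in\mathcal{Z}$. OMWU (Optimistic Multiplicative-Weights Update) with learning rate $\eta$: from $z_0=(x_0,y_0)$ and $z'_0=(x'_0,y'_0)$ in $\operatorname{ri}\mathcal{Z}$, for $t\ge 0$ set $g_{\mathcal{X},t}=\nabla_x f(z'_t)$, $g_{\mathcal{Y},t}=-\nabla_y f(z'_t)$, and $$x_{t+1,i}=\frac{x_{t,i}e^{-\eta g_{\mathcal{X},t,i}}}{\sum_{\ell=1}^n x_{t,\ell}e^{-\eta g_{\mathcal{X},t,\ell}}},\qquad y_{t+1,j}=\frac{y_{t,j}e^{-\eta g_{\mathcal{Y},t,j}}}{\sum_{\ell=1}^m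 y_{t,\ell}e^{-\eta g_{\mathcal{Y},t,\ell}}},$$ $$x'_{t+1,i}=\frac{x_{t+1,i}e^{-\eta g_{\mathcal{X},t,i}}}{\sum_{\ell=1}^n x_{t+1,\ell}e^{-\eta g_{\mathcal{X},t,\ell}}},\qquad y'_{t+1,j}=\frac{y_{t+1,j}e^{-\eta g_{\mathcal{Y},t,j}}}{\sum_{\ell=1}^m y_{t+1,\ell}e^{-\eta g_{\mathcal{Y},t,\ell}}},$$ with $z_{t}=(x_{t},y_{t})$ and $z'_{t}=(x'_{t},y'_{t})$. *)

theory Defs
  imports "HOL-Analysis.Analysis"
begin

definition prob_simplex :: "(real ^ 'n) set" where
  "prob_simplex = {p. (\<forall>i. 0 \<le> p $ i) \<and> (\<Sum>i\<in>UNIV. p $ i) = 1}"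

definition strategies :: "((real ^ 'n) \<times> (real ^ 'm)) set" where
  "strategies = prob_simplex \<times> prob_simplex"

definition supp :: "real ^ 'n \<Rightarrow> 'n set" where
  "supp p = {i. 0 < p $ i}"

(* The function f matters only on the set S, so a gradient is a field representing the derivative
   within S: fst (grad z) and snd (grad z) are the partial gradients and their coordinates the
   partial derivatives. On a product of simplices such a field is determined only up to adding
   constant vectors in each block; the lemma after this definition shows that the coordinatewise
   partial derivatives are an instance whenever f is differentiable in the ambient space. *)
definition gradient_field_on ::
  "('a :: real_inner \<Rightarrow> 'a) \<Rightarrow> ('a \<Rightarrow> real) \<Rightarrow> 'a set \<Rightarrow> bool" where
  "gradient_field_on grad f S \<longleftrightarrow>
     (\<forall>z\<in>S. (f has_derivative (\<lambda>h. grad z \<bullet> h)) (at z within S))"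

lemma gradient_field_on_partial_derivatives:
  fixes f :: "(real ^ 'n) \<times> (real ^ 'm) \<Rightarrow> real"
  assumes "\<And>z. z \<in> S \<Longrightarrow> f differentiable (at z)"
  shows "gradient_field_on
           (\<lambda>z. (\<chi> i. frechet_derivative f (at z) (axis i 1, 0),
                 \<chi> j. frechet_derivative f (at z) (0, axis j 1))) f S"
  unfolding gradient_field_on_def
proof
  fix z assume "z \<in> S"
  define D where "D = frechet_derivative f (at z)"
  have D: "(f has_derivative D) (at z)"
    using assms[OF \<open>z \<in> S\<close>] unfolding D_def by (simp add: frechet_derivative_works)
  then have lin: "linear D" by (rule has_derivative_linear)
  have "D h = (\<chi> i. D (axis i 1, 0), \<chi> j. D (0, axis j 1)) \<bullet> h" for h
  proof -
    obtain a b where h: "h = (a, b)" by (cases h)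
    have l1: "linear (\<lambda>a. D (a, 0))" and l2: "linear (\<lambda>b. D (0, b))"
      using linear_add[OF lin] linear_scale[OF lin]
      by (auto intro!: linearI simp flip: add_Pair scaleR_Pair)
         (metis add_Pair add.right_neutral scaleR_Pair scaleR_zero_right real_scaleR_def)+
    have "D (a, 0) = (\<Sum>i\<in>UNIV. a $ i * D (axis i 1, 0))"
      using linear_sum[OF l1, of "\<lambda>i. a $ i *\<^sub>R axis i 1" UNIV] linear_scale[OF l1]
      by (simp add: basis_expansion scalar_mult_eq_scaleR[symmetric])
    moreover have "D (0, b) = (\<Sum>j\<in>UNIV. b $ j * D (0, axis j 1))"
      using linear_sum[OF l2, of "\<lambda>j. b $ j *\<^sub>R axis j 1" UNIV] linear_scale[OF l2]
      by (simp add: basis_expansion scalar_mult_eq_scaleR[symmetric])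
    moreover have "D (a, b) = D (a, 0) + D (0, b)"
      using linear_add[OF lin, of "(a, 0)" "(0, b)"] by simp
    ultimately show ?thesis by (simp add: h inner_vec_def mult.commute)
  qed
  then have "D = (\<lambda>h. (\<chi> i. D (axis i 1, 0), \<chi> j. D (0, axis j 1)) \<bullet> h)" by blast
  with D show "(f has_derivative (\<lambda>h. (\<chi> i. frechet_derivative f (at z) (axis i 1, 0),
      \<chi> j. frechet_derivative f (at z) (0, axis j 1)) \<bullet> h)) (at z within S)"
    unfolding D_def[symmetric] by (metis has_derivative_at_withinI)
qed

definition saddle_point :: "((real ^ 'n) \<times> (real ^ 'm) \<Rightarrow> real) \<Rightarrow> (real ^ 'n) \<times> (real ^ 'm) \<Rightarrow> bool" where
  "saddle_point f zs \<longleftrightarrow> zs \<in> strategies \<and>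
     (\<forall>(x, y) \<in> strategies. f (fst zs, y) \<le> f zs \<and> f zs \<le> f (x, snd zs))"

definition saddle_operator ::
  "((real ^ 'n) \<times> (real ^ 'm) \<Rightarrow> (real ^ 'n) \<times> (real ^ 'm)) \<Rightarrow>
   (real ^ 'n) \<times> (real ^ 'm) \<Rightarrow> (real ^ 'n) \<times> (real ^ 'm)" where
  "saddle_operator grad z = (fst (grad z), - snd (grad z))"

definition l1_norm :: "real ^ 'n \<Rightarrow> real" where
  "l1_norm p = (\<Sum>i\<in>UNIV. \<bar>p $ i\<bar>)"

definition strategy_norm :: "(real ^ 'n) \<times> (real ^ 'm) \<Rightarrow> real" where
  "strategy_norm z = sqrt ((l1_norm (fst z))\<^sup>2 + (l1_norm (snd z))\<^sup>2)"

definition dual_strategy_norm :: "(real ^ 'n) \<times> (real ^ 'm) \<Rightarrow> real" where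
  "dual_strategy_norm g = sqrt ((infnorm (fst g))\<^sup>2 + (infnorm (snd g))\<^sup>2)"

definition lipschitz_operator ::
  "real \<Rightarrow> ((real ^ 'n) \<times> (real ^ 'm) \<Rightarrow> (real ^ 'n) \<times> (real ^ 'm)) \<Rightarrow> bool" where
  "lipschitz_operator L G \<longleftrightarrow>
     (\<forall>z\<in>strategies. \<forall>w\<in>strategies. dual_strategy_norm (G z - G w) \<le> L * strategy_norm (z - w))"

definition mwu_step :: "real \<Rightarrow> real ^ 'n \<Rightarrow> real ^ 'n \<Rightarrow> real ^ 'n" where
  "mwu_step \<eta> g p =
     (\<chi> i. p $ i * exp (- \<eta> * g $ i) / (\<Sum>l\<in>UNIV. p $ l * exp (- \<eta> * g $ l)))"

definition mwu_step_pair ::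
  "real \<Rightarrow> (real ^ 'n) \<times> (real ^ 'm) \<Rightarrow> (real ^ 'n) \<times> (real ^ 'm) \<Rightarrow> (real ^ 'n) \<times> (real ^ 'm)" where
  "mwu_step_pair \<eta> g z = (mwu_step \<eta> (fst g) (fst z), mwu_step \<eta> (snd g) (snd z))"

definition omwu ::
  "real \<Rightarrow> ((real ^ 'n) \<times> (real ^ 'm) \<Rightarrow> (real ^ 'n) \<times> (real ^ 'm)) \<Rightarrow>
   (nat \<Rightarrow> (real ^ 'n) \<times> (real ^ 'm)) \<Rightarrow> (nat \<Rightarrow> (real ^ 'n) \<times> (real ^ 'm)) \<Rightarrow> bool" where
  "omwu \<eta> G z z' \<longleftrightarrow>
     z 0 \<in> rel_interior strategies \<and> z' 0 \<in> rel_interior strategies \<and>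
     (\<forall>t. z (Suc t) = mwu_step_pair \<eta> (G (z' t)) (z t) \<and>
          z' (Suc t) = mwu_step_pair \<eta> (G (z' t)) (z (Suc t)))"

definition cluster_point :: "(nat \<Rightarrow> 'a :: metric_space) \<Rightarrow> 'a \<Rightarrow> bool" where
  "cluster_point z c \<longleftrightarrow> (\<exists>r. strict_mono r \<and> (z \<circ> r) \<longlonglongrightarrow> c)"

definition active_face_constants ::
  "((real ^ 'n) \<times> (real ^ 'm) \<Rightarrow> (real ^ 'n) \<times> (real ^ 'm)) \<Rightarrow>
   (real ^ 'n) \<times> (real ^ 'm) \<Rightarrow> real \<Rightarrow> real \<Rightarrow> bool" where
  "active_face_constants grad z ax ay \<longleftrightarrow>
     (\<forall>i\<in>supp (fst z). fst (grad z) $ i = ax) \<and>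
     (\<forall>j\<in>supp (snd z). - snd (grad z) $ j = ay)"

end

theory Submission
  imports Defs
begin

text \<open>
  Let \<open>c\<close> be a cluster point. The proof has two layers, both resting on one energy inequality.

  \<^emph>\<open>Energy.\<close> For a comparator \<open>u\<close> the energy at time \<open>t\<close> is the relative entropy from
  \<open>u\<close> to the iterate plus a multiple of the squared last prediction gap \<open>z (Suc t) - z' t\<close>. The
  three-point identity of a multiplicative-weights step, Pinsker's inequality and the Lipschitz
  bound give \<open>energy_descent\<close>: the energy drops by a positive multiple of the squared gaps,
  up to the term \<open>\<eta> * (G z' \<bullet> (z' - u))\<close>; this is where \<open>\<eta> * L < 1 / 3\<close> enters. If \<open>u\<close> is a
  saddle point, then that term is nonnegative, so all gaps between consecutive points tend to
  zero. Hence a cluster point is a fixed point of the update, which forces the operator to be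
  constant on the support of each block of \<open>c\<close>: the active-face constants exist.

  \<^emph>\<open>Optimality.\<close> Suppose that some coordinate outside the support of \<open>c\<close> has operator value below
  the active constant. Let \<open>W\<close> be the vector of these deficits and let \<open>M t\<close> be the inner product
  of \<open>W\<close> with the iterate, which is positive because iterates stay in the interior. Near \<open>c\<close> two
  things happen. The multiplicative weights push the deficient coordinates up, so \<open>M\<close> grows by
  a fixed factor \<open>q > 1\<close> in every step. And although \<open>c\<close> is not known to be a saddle point,
  monotonicity shows that the energy relative to \<open>c\<close> itself can rise in a step by at most a
  constant times \<open>M t\<close>, since the deficient coordinates are the only source of a negative
  \<open>G c \<bullet> (z' - c)\<close>.

  The gaps tend to zero, so the increments of \<open>M\<close> do; by growth, \<open>M\<close> itself is then small whenever
  the iterate is near \<open>c\<close>. The geometric growth makes the total energy rise during a stay near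
  \<open>c\<close> comparable to the last value of \<open>M\<close>, hence small as well. An iterate that comes close enough
  to \<open>c\<close> late enough is therefore trapped near \<open>c\<close> for ever, where \<open>M\<close> never decreases
  and its increments stay bounded away from zero: a contradiction (\<open>unstable_mass_contradiction\<close>).
\<close>

section \<open>The norm pair\<close>

lemma l1_norm_nonneg: "0 \<le> l1_norm p"
  unfolding l1_norm_def by (simp add: sum_nonneg)

lemma l1_norm_triangle: "l1_norm (p + q) \<le> l1_norm p + l1_norm q"
  unfolding l1_norm_def sum.distrib[symmetric] by (intro sum_mono) simp

lemma norm_le_l1_norm: "norm p \<le> l1_norm p"
  unfolding l1_norm_def by (rule norm_le_l1_cart)

lemma strategy_norm_nonneg: "0 \<le> strategy_norm z"
  unfolding strategy_norm_def by simp

lemma strategy_norm_minus_commute: "strategy_norm (z - w) = strategy_norm (w - z)"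
  unfolding strategy_norm_def l1_norm_def by (simp add: abs_minus_commute)

lemma strategy_norm_triangle: "strategy_norm (z + w) \<le> strategy_norm z + strategy_norm w"
proof -
  have "strategy_norm (z + w) \<le>
      sqrt ((l1_norm (fst z) + l1_norm (fst w))\<^sup>2 + (l1_norm (snd z) + l1_norm (snd w))\<^sup>2)"
    unfolding strategy_norm_def
    by (intro real_sqrt_le_mono add_mono power_mono) (simp_all add: l1_norm_nonneg l1_norm_triangle)
  also have "\<dots> \<le> strategy_norm z + strategy_norm w"
    unfolding strategy_norm_def by (rule real_sqrt_sum_squares_triangle_ineq)
  finally show ?thesis .
qed

lemma norm_le_strategy_norm: "norm z \<le> strategy_norm z"
  unfolding strategy_norm_def norm_prod_def
  by (rule real_sqrt_le_mono[OF add_mono[OF power_mono[OF norm_le_l1_norm norm_ge_zero]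
      power_mono[OF norm_le_l1_norm norm_ge_zero]]])

lemma strategy_norm_tendsto_0:
  assumes "(u \<longlongrightarrow> 0) F"
  shows "((\<lambda>t. strategy_norm (u t)) \<longlongrightarrow> 0) F"
proof -
  have l1: "((\<lambda>t. l1_norm (v t)) \<longlongrightarrow> 0) F" if "(v \<longlongrightarrow> 0) F" for v :: "'a \<Rightarrow> real ^ 'k"
    unfolding l1_norm_def
  proof (rule tendsto_null_sum)
    fix i
    have "((\<lambda>t. v t $ i) \<longlongrightarrow> 0) F"
      using tendsto_vec_nth[OF that, of i] by simp
    then show "((\<lambda>t. \<bar>v t $ i\<bar>) \<longlongrightarrow> 0) F" by (rule tendsto_rabs_zero)
  qed
  have "((\<lambda>t. sqrt ((l1_norm (fst (u t)))\<^sup>2 + (l1_norm (snd (u t)))\<^sup>2)) \<longlongrightarrow> sqrt (0\<^sup>2 + 0\<^sup>2)) F"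
    using tendsto_fst[OF assms] tendsto_snd[OF assms] by (intro tendsto_intros l1) simp_all
  then show ?thesis by (simp add: strategy_norm_def)
qed

lemma inner_le_infnorm_l1_norm: "a \<bullet> p \<le> infnorm a * l1_norm p"
proof -
  have "a $ i * p $ i \<le> infnorm a * \<bar>p $ i\<bar>" for i
  proof (rule order_trans)
    show "a $ i * p $ i \<le> \<bar>a $ i\<bar> * \<bar>p $ i\<bar>" unfolding abs_mult[symmetric] by (rule abs_ge_self)
    show "\<bar>a $ i\<bar> * \<bar>p $ i\<bar> \<le> infnorm a * \<bar>p $ i\<bar>"
      by (rule mult_right_mono[OF component_le_infnorm_cart abs_ge_zero])
  qed
  then show ?thesis
    unfolding inner_vec_def l1_norm_def sum_distrib_left inner_real_def by (intro sum_mono)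
qed

lemma inner_le_dual_strategy_norm: "g \<bullet> h \<le> dual_strategy_norm g * strategy_norm h"
proof -
  have "g \<bullet> h \<le> infnorm (fst g) * l1_norm (fst h) + infnorm (snd g) * l1_norm (snd h)"
    unfolding inner_prod_def by (intro add_mono inner_le_infnorm_l1_norm)
  also have "\<dots> = (infnorm (fst g), infnorm (snd g)) \<bullet> (l1_norm (fst h), l1_norm (snd h))"
    by simp
  also have "\<dots> \<le> dual_strategy_norm g * strategy_norm h"
    using norm_cauchy_schwarz[of "(infnorm (fst g), infnorm (snd g))" "(l1_norm (fst h), l1_norm (snd h))"]
    by (simp add: dual_strategy_norm_def strategy_norm_def norm_Pair)
  finally show ?thesis .
qed

lemma norm_le_dual_strategy_norm:
  fixes g :: "(real ^ 'n) \<times> (real ^ 'm)"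
  shows "norm g \<le> (sqrt CARD('n) + sqrt CARD('m)) * dual_strategy_norm g"
proof -
  have blocks: "infnorm (fst g) \<le> dual_strategy_norm g" "infnorm (snd g) \<le> dual_strategy_norm g"
    unfolding dual_strategy_norm_def by simp_all
  have tri: "norm g \<le> norm (fst g) + norm (snd g)"
    using norm_Pair_le[of "fst g" "snd g"] by simp
  have inf: "norm (fst g) + norm (snd g) \<le> sqrt CARD('n) * infnorm (fst g) + sqrt CARD('m) * infnorm (snd g)"
    using norm_le_infnorm[of "fst g"] norm_le_infnorm[of "snd g"] by (simp add: add_mono)
  have dual: "sqrt CARD('n) * infnorm (fst g) + sqrt CARD('m) * infnorm (snd g)
      \<le> (sqrt CARD('n) + sqrt CARD('m)) * dual_strategy_norm g"
    by (simp add: distrib_right add_mono mult_left_mono blocks)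
  show ?thesis by (rule order_trans[OF tri order_trans[OF inf dual]])
qed

lemma lipschitz_operator_continuous_on:
  fixes G :: "(real ^ 'n) \<times> (real ^ 'm) \<Rightarrow> (real ^ 'n) \<times> (real ^ 'm)"
  assumes "lipschitz_operator L G"
  shows "continuous_on strategies G"
  unfolding continuous_on_def
proof
  fix w :: "(real ^ 'n) \<times> (real ^ 'm)" assume w: "w \<in> strategies"
  define C where "C = sqrt CARD('n) + sqrt CARD('m)"
  have C: "0 \<le> C" by (simp add: C_def)
  have "((\<lambda>z. z - w) \<longlongrightarrow> w - w) (at w within strategies)"
    by (rule tendsto_diff[OF tendsto_ident_at tendsto_const])
  then have diff: "((\<lambda>z. z - w) \<longlongrightarrow> 0) (at w within strategies)" by simp
  have lim: "((\<lambda>z. C * (L * strategy_norm (z - w))) \<longlongrightarrow> 0) (at w within strategies)"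
    by (rule tendsto_mult_right_zero[OF tendsto_mult_right_zero[OF strategy_norm_tendsto_0[OF diff]]])
  have "norm (G z - G w) \<le> C * (L * strategy_norm (z - w))" if z: "z \<in> strategies" for z
  proof (rule order_trans)
    show "norm (G z - G w) \<le> C * dual_strategy_norm (G z - G w)"
      unfolding C_def by (rule norm_le_dual_strategy_norm)
    have "dual_strategy_norm (G z - G w) \<le> L * strategy_norm (z - w)"
      using assms z w unfolding lipschitz_operator_def by blast
    then show "C * dual_strategy_norm (G z - G w) \<le> C * (L * strategy_norm (z - w))"
      by (rule mult_left_mono[OF _ C])
  qed
  then have "\<forall>\<^sub>F z in at w within strategies. norm (G z - G w) \<le> C * (L * strategy_norm (z - w))"
    by (simp add: eventually_at_filter)
  from Lim_null_comparison[OF this lim]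
  show "(G \<longlongrightarrow> G w) (at w within strategies)" by (simp add: LIM_zero_iff)
qed

section \<open>Relative entropy on the simplex\<close>

lemma prob_simplexD:
  assumes "p \<in> prob_simplex"
  shows "0 \<le> p $ i" "(\<Sum>i\<in>UNIV. p $ i) = 1"
  using assms by (auto simp: prob_simplex_def)

lemma closed_prob_simplex: "closed (prob_simplex :: (real ^ 'n) set)"
  unfolding prob_simplex_def
  by (intro closed_Collect_conj closed_Collect_all closed_Collect_le closed_Collect_eq continuous_intros)

lemma convex_prob_simplex: "convex (prob_simplex :: (real ^ 'n) set)"
  unfolding convex_def prob_simplex_def
  by (simp add: sum.distrib sum_distrib_left[symmetric])

lemma axis_in_prob_simplex: "axis i 1 \<in> prob_simplex"
  unfolding prob_simplex_def by (auto simp: axis_def)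

definition pos_simplex :: "(real ^ 'n) set" where
  "pos_simplex = {p \<in> prob_simplex. \<forall>i. 0 < p $ i}"

text \<open>
  A relative interior point can be pushed a little beyond itself, away from the vertex \<open>axis i 1\<close>,
  without leaving the simplex; a vanishing coordinate \<open>i\<close> would become negative.
\<close>

lemma rel_interior_prob_simplex: "rel_interior prob_simplex \<subseteq> pos_simplex"
proof
  fix p :: "real ^ 'n" assume p: "p \<in> rel_interior prob_simplex"
  then have p_in: "p \<in> prob_simplex" using rel_interior_subset by blast
  have "0 < p $ i" for i
  proof -
    have "axis i 1 \<in> (prob_simplex :: (real ^ 'n) set)" by (rule axis_in_prob_simplex)
    then obtain e where e: "e > 1" "(1 - e) *\<^sub>R axis i 1 + e *\<^sub>R p \<in> prob_simplex"
      using convex_rel_interior_iff[OF convex_prob_simplex] p by blast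
    have "0 \<le> (1 - e) + e * p $ i"
      using prob_simplexD(1)[OF e(2), of i] by simp
    then show ?thesis
      using e(1) prob_simplexD(1)[OF p_in, of i] by (cases "p $ i = 0") auto
  qed
  then show "p \<in> pos_simplex" using p_in by (simp add: pos_simplex_def)
qed

definition relative_entropy :: "real ^ 'n \<Rightarrow> real ^ 'n \<Rightarrow> real" where
  "relative_entropy p q = (\<Sum>i\<in>UNIV. p $ i * ln (p $ i / q $ i))"

text \<open>
  The difference of the two sides, divided by \<open>u * (2 * u + 4)\<close>, has the derivative
  \<open>(u - 1) ^ 3 / (u * (u + 2))\<^sup>2\<close>, so it is minimal at \<open>u = 1\<close>, where it vanishes.
\<close>

lemma pinsker_scalar:
  fixes u :: real
  assumes "0 < u"
  shows "3 * (u - 1)\<^sup>2 \<le> (2 * u + 4) * (u * ln u - u + 1)"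
proof -
  define F where "F = (\<lambda>u::real. ln u - 1 + 1 / u - 3 * (u - 1)\<^sup>2 / (u * (2 * u + 4)))"
  define F' where "F' = (\<lambda>u::real. (u - 1) ^ 3 / (u * (u + 2))\<^sup>2)"
  have der: "(F has_real_derivative F' v) (at v)" if v: "0 < v" for v
  proof -
    have "(F has_real_derivative (1 / v - 1 / v\<^sup>2
        - (6 * (v - 1) * (v * (2 * v + 4)) - 3 * (v - 1)\<^sup>2 * (4 * v + 4)) / (v * (2 * v + 4))\<^sup>2)) (at v)"
    proof -
      have "v * (2 * v + 4) \<noteq> 0" using v by simp
      then show ?thesis
        unfolding F_def using v
        by (auto intro!: derivative_eq_intros simp: power2_eq_square algebra_simps)
    qed
    moreover have "1 / v - 1 / v\<^sup>2
        - (6 * (v - 1) * (v * (2 * v + 4)) - 3 * (v - 1)\<^sup>2 * (4 * v + 4)) / (v * (2 * v + 4))\<^sup>2 = F' v"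
    proof -
      have "(v * (2 * v + 4))\<^sup>2 = 4 * (v * (v + 2))\<^sup>2" by algebra
      moreover have "1 / v - 1 / v\<^sup>2 = (v - 1) * (v + 2)\<^sup>2 / (v * (v + 2))\<^sup>2"
        using v by (simp add: divide_simps power2_eq_square)
      moreover have "(6 * (v - 1) * (v * (2 * v + 4)) - 3 * (v - 1)\<^sup>2 * (4 * v + 4))
          = 4 * (3 * (v - 1) * (2 * v + 1))" by algebra
      moreover have "(v - 1) * (v + 2)\<^sup>2 - 3 * (v - 1) * (2 * v + 1) = (v - 1) ^ 3" by algebra
      ultimately show ?thesis
        unfolding F'_def by (simp add: diff_divide_distrib[symmetric])
    qed
    ultimately show ?thesis by simp
  qed
  have "F 1 \<le> F u"
  proof (cases "1 \<le> u")
    case True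
    show ?thesis
    proof (rule DERIV_nonneg_imp_nondecreasing[OF True])
      fix v :: real assume "1 \<le> v" "v \<le> u"
      then show "\<exists>y. DERIV F v :> y \<and> 0 \<le> y"
        using der[of v] by (intro exI[of _ "F' v"]) (simp add: F'_def)
    qed
  next
    case False
    then have "u \<le> 1" by simp
    then show ?thesis
    proof (rule DERIV_nonpos_imp_nonincreasing)
      fix v :: real assume v: "u \<le> v" "v \<le> 1"
      have "(v - 1) ^ 3 \<le> 0" using v by (simp add: power_le_zero_eq)
      then have "F' v \<le> 0" unfolding F'_def by (intro divide_nonpos_nonneg) simp_all
      then show "\<exists>y. DERIV F v :> y \<and> y \<le> 0"
        using der[of v] v assms by (intro exI[of _ "F' v"]) simp
    qed
  qed
  then have "0 \<le> F u * (u * (2 * u + 4))"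
    using assms by (simp add: F_def)
  also have "\<dots> = (2 * u + 4) * (u * ln u - u + 1) - 3 * (u - 1)\<^sup>2"
    using assms by (simp add: F_def divide_simps) (simp add: algebra_simps)
  finally show ?thesis by simp
qed

lemma pinsker_weighted:
  fixes p q :: real
  assumes "0 \<le> p" "0 < q"
  shows "3 * (p - q)\<^sup>2 \<le> (2 * p + 4 * q) * (p * ln (p / q) - p + q)"
proof (cases "p = 0")
  case True
  then show ?thesis by (simp add: power2_eq_square)
next
  case False
  define u where "u = p / q"
  have u: "0 < u" "p = u * q" using False assms by (auto simp: u_def)
  have "3 * (p - q)\<^sup>2 = q\<^sup>2 * (3 * (u - 1)\<^sup>2)"
    unfolding u(2) by algebra
  also have "\<dots> \<le> q\<^sup>2 * ((2 * u + 4) * (u * ln u - u + 1))"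
    by (intro mult_left_mono pinsker_scalar u) simp
  also have "\<dots> = (2 * p + 4 * q) * (p * ln (p / q) - p + q)"
    unfolding u_def[symmetric] unfolding u(2) by algebra
  finally show ?thesis .
qed

text \<open>
  Pinsker's inequality by Cauchy-Schwarz: the pointwise bound writes \<open>\<bar>p $ i - q $ i\<bar>\<close> as at most
  a product of square roots whose squares sum to \<open>2\<close> and to the relative entropy. The first
  argument may lie on the boundary of the simplex, as cluster points and saddle points do.
\<close>

lemma pinsker:
  assumes p: "p \<in> prob_simplex" and q: "q \<in> pos_simplex"
  shows "(l1_norm (p - q))\<^sup>2 \<le> 2 * relative_entropy p q"
proof -
  define A where "A i = (2 * p $ i + 4 * q $ i) / 3" for i
  define B where "B i = p $ i * ln (p $ i / q $ i) - p $ i + q $ i" for i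
  have q': "q \<in> prob_simplex" "\<And>i. 0 < q $ i" using q by (auto simp: pos_simplex_def)
  have AB: "(p $ i - q $ i)\<^sup>2 \<le> A i * B i" for i
    using pinsker_weighted[OF prob_simplexD(1)[OF p, of i] q'(2)[of i]] by (simp add: A_def B_def)
  have A: "0 < A i" for i
    using prob_simplexD(1)[OF p, of i] q'(2)[of i] by (simp add: A_def)
  have B: "0 \<le> B i" for i
    using AB[of i] A[of i] by (smt (verit) zero_le_power2 zero_le_mult_iff)
  have "l1_norm (p - q) \<le> (\<Sum>i\<in>UNIV. sqrt (A i) * sqrt (B i))"
    unfolding l1_norm_def
  proof (rule sum_mono)
    fix i
    show "\<bar>(p - q) $ i\<bar> \<le> sqrt (A i) * sqrt (B i)"
      using real_sqrt_le_mono[OF AB[of i]] by (simp add: real_sqrt_mult)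
  qed
  then have "(l1_norm (p - q))\<^sup>2 \<le> (\<Sum>i\<in>UNIV. sqrt (A i) * sqrt (B i))\<^sup>2"
    by (intro power_mono l1_norm_nonneg)
  also have "\<dots> \<le> (\<Sum>i\<in>UNIV. (sqrt (A i))\<^sup>2) * (\<Sum>i\<in>UNIV. (sqrt (B i))\<^sup>2)"
    by (rule Cauchy_Schwarz_ineq_sum)
  also have "\<dots> = (\<Sum>i\<in>UNIV. A i) * (\<Sum>i\<in>UNIV. B i)"
    using A B by (simp add: less_imp_le)
  also have "(\<Sum>i\<in>UNIV. A i) = 2"
    unfolding A_def sum_divide_distrib[symmetric] sum.distrib sum_distrib_left[symmetric]
    by (simp add: prob_simplexD(2)[OF p] prob_simplexD(2)[OF q'(1)])
  also have "(\<Sum>i\<in>UNIV. B i) = relative_entropy p q"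
    unfolding B_def relative_entropy_def sum.distrib sum_subtractf
    by (simp add: prob_simplexD(2)[OF p] prob_simplexD(2)[OF q'(1)])
  finally show ?thesis .
qed

text \<open>
  Coordinates outside the support of \<open>p\<close> contribute nothing, so the convergence holds also for a
  limit on the boundary.
\<close>

lemma relative_entropy_tendsto_0:
  assumes "p \<in> prob_simplex" and "(q \<longlongrightarrow> p) F"
  shows "((\<lambda>t. relative_entropy p (q t)) \<longlongrightarrow> 0) F"
proof -
  have "((\<lambda>t. p $ i * ln (p $ i / q t $ i)) \<longlongrightarrow> 0) F" for i
  proof (cases "p $ i = 0")
    case False
    then have "0 < p $ i" using prob_simplexD(1)[OF assms(1), of i] by simp
    then have "((\<lambda>t. p $ i * ln (p $ i / q t $ i)) \<longlongrightarrow> p $ i * ln (p $ i / p $ i)) F"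
      by (intro tendsto_intros assms(2)) auto
    with False show ?thesis by simp
  qed simp
  then have "((\<lambda>t. relative_entropy p (q t)) \<longlongrightarrow> (\<Sum>i\<in>(UNIV::'a set). 0)) F"
    unfolding relative_entropy_def by (intro tendsto_sum)
  then show ?thesis by simp
qed

section \<open>One multiplicative-weights step\<close>

lemma mwu_step_pos_simplex:
  assumes "p \<in> pos_simplex"
  shows "mwu_step \<eta> g p \<in> pos_simplex"
proof -
  have p: "0 < p $ i" for i using assms by (simp add: pos_simplex_def)
  have Z: "0 < (\<Sum>l\<in>UNIV. p $ l * exp (- \<eta> * g $ l))"
    by (intro sum_pos) (simp_all add: p)
  then show ?thesis
    by (auto simp: pos_simplex_def prob_simplex_def mwu_step_def p less_imp_le sum_divide_distrib[symmetric])
qed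

text \<open>
  For every \<open>v\<close> in the simplex, one step changes the relative entropy from \<open>v\<close> by the affine
  quantity \<open>\<eta> * (g \<bullet> v)\<close> plus the logarithm of the normaliser, which does not depend on \<open>v\<close>.
  Comparing \<open>v = u\<close> with \<open>v = mwu_step \<eta> g p\<close> cancels the normaliser.
\<close>

lemma mwu_three_point:
  assumes p: "p \<in> pos_simplex" and u: "u \<in> prob_simplex"
  shows "\<eta> * (g \<bullet> (mwu_step \<eta> g p - u)) =
    relative_entropy u p - relative_entropy u (mwu_step \<eta> g p) - relative_entropy (mwu_step \<eta> g p) p"
proof -
  define Z where "Z = (\<Sum>l\<in>UNIV. p $ l * exp (- \<eta> * g $ l))"
  define p1 where "p1 = mwu_step \<eta> g p"
  have pp: "0 < p $ i" for i using p by (simp add: pos_simplex_def)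
  have Z: "0 < Z"
    unfolding Z_def by (intro sum_pos) (simp_all add: pp)
  have p1: "p1 \<in> pos_simplex" unfolding p1_def by (rule mwu_step_pos_simplex[OF p])
  have drop: "relative_entropy v p - relative_entropy v p1 = - \<eta> * (g \<bullet> v) - ln Z"
    if v: "v \<in> prob_simplex" for v
  proof -
    have "v $ i * ln (v $ i / p $ i) - v $ i * ln (v $ i / p1 $ i) = - \<eta> * (g $ i * v $ i) - ln Z * v $ i" for i
    proof (cases "v $ i = 0")
      case False
      then have vi: "0 < v $ i" using prob_simplexD(1)[OF v, of i] by simp
      have "p1 $ i = p $ i * exp (- \<eta> * g $ i) / Z" by (simp add: p1_def mwu_step_def Z_def)
      then have ln_p1: "ln (p1 $ i) = ln (p $ i) - \<eta> * g $ i - ln Z"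
        using Z pp[of i] by (simp add: ln_div ln_mult)
      have "0 < p1 $ i" using p1 by (simp add: pos_simplex_def)
      then have "ln (v $ i / p1 $ i) = ln (v $ i) - (ln (p $ i) - \<eta> * g $ i - ln Z)"
        using vi by (simp add: ln_div flip: ln_p1)
      moreover have "ln (v $ i / p $ i) = ln (v $ i) - ln (p $ i)"
        using vi pp[of i] by (simp add: ln_div)
      ultimately have diff: "ln (v $ i / p $ i) - ln (v $ i / p1 $ i) = - \<eta> * g $ i - ln Z" by simp
      show ?thesis
        unfolding right_diff_distrib[symmetric] diff by (simp add: algebra_simps)
    qed simp
    then have "relative_entropy v p - relative_entropy v p1 =
        (\<Sum>i\<in>UNIV. - \<eta> * (g $ i * v $ i) - ln Z * v $ i)"
      unfolding relative_entropy_def by (simp add: sum_subtractf[symmetric])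
    also have "\<dots> = - \<eta> * (g \<bullet> v) - ln Z"
      by (simp add: sum_subtractf sum_distrib_left[symmetric] prob_simplexD(2)[OF v]
          inner_vec_def sum_negf)
    finally show ?thesis .
  qed
  have "relative_entropy p1 p1 = 0"
    using p1 unfolding relative_entropy_def pos_simplex_def
    by (intro sum.neutral) (auto simp: less_imp_neq[symmetric])
  moreover have "p1 \<in> prob_simplex" using p1 by (simp add: pos_simplex_def)
  ultimately show ?thesis
    using drop[OF u] drop[of p1] unfolding p1_def[symmetric]
    by (simp add: inner_diff_right algebra_simps)
qed

text \<open>
  At a fixed point every supported coordinate is multiplied by one, so its weight
  \<open>exp (- \<eta> * g $ i)\<close> equals the common normaliser.
\<close>

lemma mwu_fixed_point_active_constant:
  assumes "0 < \<eta>" and "mwu_step \<eta> g p = p"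
  shows "\<exists>a. \<forall>i\<in>supp p. g $ i = a"
proof -
  define Z where "Z = (\<Sum>l\<in>UNIV. p $ l * exp (- \<eta> * g $ l))"
  have "g $ i = - ln Z / \<eta>" if "i \<in> supp p" for i
  proof -
    have p: "0 < p $ i" using that by (simp add: supp_def)
    have "p $ i = p $ i * exp (- \<eta> * g $ i) / Z"
      using arg_cong[OF assms(2), of "\<lambda>q. q $ i"] by (simp add: mwu_step_def Z_def)
    then have "Z = exp (- \<eta> * g $ i)"
      using p by (cases "Z = 0") (auto simp: field_simps)
    then show ?thesis using assms(1) by simp
  qed
  then show ?thesis by blast
qed

lemma mwu_weights_sum_pos:
  assumes "p \<in> prob_simplex"
  shows "0 < (\<Sum>l\<in>UNIV. p $ l * exp (- \<eta> * g $ l))"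
proof -
  have "\<exists>i. p $ i \<noteq> 0"
  proof (rule ccontr)
    assume "\<nexists>i. p $ i \<noteq> 0"
    then show False using prob_simplexD(2)[OF assms] by simp
  qed
  then obtain i where "0 < p $ i"
    using prob_simplexD(1)[OF assms] by (metis less_eq_real_def)
  then show ?thesis
    by (intro sum_pos2[of _ i]) (simp_all add: prob_simplexD(1)[OF assms])
qed

lemma mwu_step_tendsto:
  assumes "(\<gamma> \<longlongrightarrow> g) F" and "(\<xi> \<longlongrightarrow> p) F" and "p \<in> prob_simplex"
  shows "((\<lambda>t. mwu_step \<eta> (\<gamma> t) (\<xi> t)) \<longlongrightarrow> mwu_step \<eta> g p) F"
proof (rule vec_tendstoI)
  fix i
  have "((\<lambda>t. \<xi> t $ i * exp (- \<eta> * \<gamma> t $ i) / (\<Sum>l\<in>UNIV. \<xi> t $ l * exp (- \<eta> * \<gamma> t $ l)))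
      \<longlongrightarrow> p $ i * exp (- \<eta> * g $ i) / (\<Sum>l\<in>UNIV. p $ l * exp (- \<eta> * g $ l))) F"
    using mwu_weights_sum_pos[OF assms(3), of \<eta> g] by (intro tendsto_intros assms(1,2)) simp
  then show "((\<lambda>t. mwu_step \<eta> (\<gamma> t) (\<xi> t) $ i) \<longlongrightarrow> mwu_step \<eta> g p $ i) F"
    by (simp add: mwu_step_def)
qed

text \<open>
  The amounts by which the coordinates of \<open>g\<close> violate optimality with respect to the constant \<open>a\<close>;
  the vector vanishes exactly when \<open>a\<close> bounds \<open>g\<close> from below, and it weights the coordinates in
  the quantity that is shown to be unstable.
\<close>

definition deficit :: "real \<Rightarrow> real ^ 'n \<Rightarrow> real ^ 'n" where
  "deficit a g = (\<chi> j. max 0 (a - g $ j))"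

lemma deficit_inner_nonneg:
  assumes "x \<in> prob_simplex"
  shows "0 \<le> deficit a g \<bullet> x"
  unfolding inner_vec_def using prob_simplexD(1)[OF assms]
  by (intro sum_nonneg) (simp add: deficit_def)

lemma deficit_inner_pos:
  assumes "deficit a g \<noteq> 0" and x: "x \<in> pos_simplex"
  shows "0 < deficit a g \<bullet> x"
proof -
  obtain j where "deficit a g $ j \<noteq> 0" using assms(1) by (auto simp: vec_eq_iff)
  then have "0 < deficit a g $ j" by (simp add: deficit_def split: if_splits)
  then show ?thesis
    unfolding inner_vec_def using x
    by (intro sum_pos2[of _ j]) (auto simp: pos_simplex_def prob_simplex_def deficit_def)
qed

text \<open>
  Shifting \<open>g\<close> by the constant \<open>a\<close> does not change its inner product with a difference of two
  simplex points. After the shift only coordinates outside the support of \<open>p\<close> contribute, and a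
  negative contribution needs a positive deficit.
\<close>

lemma inner_ge_neg_deficit:
  assumes p: "p \<in> prob_simplex" and x: "x \<in> prob_simplex"
    and active: "\<forall>i\<in>supp p. g $ i = a"
  shows "- (deficit a g \<bullet> x) \<le> g \<bullet> (x - p)"
proof -
  have "g \<bullet> (x - p) = (\<Sum>j\<in>UNIV. (g $ j - a) * (x $ j - p $ j)) + a * (\<Sum>j\<in>UNIV. x $ j - p $ j)"
    by (simp add: inner_vec_def sum_distrib_left sum.distrib[symmetric] algebra_simps)
  also have "(\<Sum>j\<in>UNIV. x $ j - p $ j) = 0"
    by (simp add: sum_subtractf prob_simplexD(2)[OF p] prob_simplexD(2)[OF x])
  finally have eq: "g \<bullet> (x - p) = (\<Sum>j\<in>UNIV. (g $ j - a) * (x $ j - p $ j))" by simp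
  have "- (deficit a g $ j * x $ j) \<le> (g $ j - a) * (x $ j - p $ j)" for j
  proof (cases "j \<in> supp p")
    case True
    then show ?thesis using active by (simp add: deficit_def)
  next
    case False
    then have "p $ j = 0"
      using prob_simplexD(1)[OF p, of j] by (simp add: supp_def)
    moreover have "(a - g $ j) * x $ j \<le> deficit a g $ j * x $ j"
      by (intro mult_right_mono prob_simplexD(1)[OF x]) (simp add: deficit_def)
    ultimately show ?thesis by (simp add: algebra_simps)
  qed
  then have "(\<Sum>j\<in>UNIV. - (deficit a g $ j * x $ j)) \<le> g \<bullet> (x - p)"
    unfolding eq by (intro sum_mono)
  then show ?thesis by (simp add: inner_vec_def sum_negf)
qed

text \<open>
  In the limit the normaliser is \<open>exp (- \<eta> * a)\<close>, so the step multiplies coordinate \<open>j\<close> by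
  \<open>exp (\<eta> * (a - g $ j))\<close>, which exceeds \<open>1\<close> exactly at the deficient coordinates. Any \<open>q\<close> below
  the multipliers of the deficient coordinates and any \<open>K\<close> above all multipliers work near the limit.
\<close>

lemma mwu_deficit_growth:
  fixes p g :: "real ^ 'n"
  assumes eta: "0 < \<eta>" and p: "p \<in> prob_simplex"
    and active: "\<forall>i\<in>supp p. g $ i = a"
    and \<gamma>: "(\<gamma> \<longlongrightarrow> g) F" and \<xi>: "(\<xi> \<longlongrightarrow> p) F"
    and \<xi>_in: "\<forall>\<^sub>F c in F. \<xi> c \<in> prob_simplex"
  obtains q K where "1 < q" and "\<forall>\<^sub>F c in F.
    q * (deficit a g \<bullet> \<xi> c) \<le> deficit a g \<bullet> mwu_step \<eta> (\<gamma> c) (\<xi> c) \<and>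
    deficit a g \<bullet> mwu_step \<eta> (\<gamma> c) (\<xi> c) \<le> K * (deficit a g \<bullet> \<xi> c)"
proof -
  define \<rho> where "\<rho> c j = exp (- \<eta> * \<gamma> c $ j) / (\<Sum>l\<in>UNIV. \<xi> c $ l * exp (- \<eta> * \<gamma> c $ l))" for c j
  define r where "r j = exp (\<eta> * (a - g $ j))" for j
  have "p $ l * exp (- \<eta> * g $ l) = p $ l * exp (- \<eta> * a)" for l
    using active prob_simplexD(1)[OF p, of l] by (cases "p $ l = 0") (auto simp: supp_def)
  then have Z: "(\<Sum>l\<in>UNIV. p $ l * exp (- \<eta> * g $ l)) = exp (- \<eta> * a)"
    by (simp only: sum_distrib_right[symmetric] prob_simplexD(2)[OF p] mult_1)
  have lim: "((\<lambda>c. \<rho> c j) \<longlongrightarrow> r j) F" for j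
  proof -
    have "((\<lambda>c. \<rho> c j) \<longlongrightarrow> exp (- \<eta> * g $ j) / (\<Sum>l\<in>UNIV. p $ l * exp (- \<eta> * g $ l))) F"
      unfolding \<rho>_def by (intro tendsto_intros \<gamma> \<xi>) (simp only: Z, simp)
    then show ?thesis
      unfolding Z r_def by (simp add: exp_diff[symmetric] algebra_simps)
  qed
  have "\<forall>\<^sub>F q in at_right 1. \<forall>j. 0 < deficit a g $ j \<longrightarrow> q < r j"
  proof (intro eventually_all_finite)
    fix j
    show "\<forall>\<^sub>F q in at_right 1. 0 < deficit a g $ j \<longrightarrow> q < r j"
    proof (cases "0 < deficit a g $ j")
      case True
      then have "1 < r j" using eta by (simp add: deficit_def r_def)
      then show ?thesis by (auto simp: eventually_at_right)
    qed simp
  qed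
  then obtain q where q: "1 < q" "\<And>j. 0 < deficit a g $ j \<Longrightarrow> q < r j"
    using eventually_happens'[OF trivial_limit_at_right_real
        eventually_conj[OF _ eventually_at_right_less[of "1::real"]]] by blast
  define K where "K = 1 + (\<Sum>j\<in>UNIV. r j)"
  have K: "r j < K" for j
  proof -
    have "r j \<le> (\<Sum>j\<in>UNIV. r j)" by (intro member_le_sum) (auto simp: r_def)
    then show ?thesis by (simp add: K_def)
  qed
  have ev: "\<forall>\<^sub>F c in F. \<forall>j. \<rho> c j < K \<and> (0 < deficit a g $ j \<longrightarrow> q < \<rho> c j)"
  proof (intro eventually_all_finite eventually_conj)
    fix j
    show "\<forall>\<^sub>F c in F. \<rho> c j < K" by (rule order_tendstoD(2)[OF lim K])
    show "\<forall>\<^sub>F c in F. 0 < deficit a g $ j \<longrightarrow> q < \<rho> c j"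
      using order_tendstoD(1)[OF lim q(2)] by (cases "0 < deficit a g $ j") auto
  qed
  have "\<forall>\<^sub>F c in F.
    q * (deficit a g \<bullet> \<xi> c) \<le> deficit a g \<bullet> mwu_step \<eta> (\<gamma> c) (\<xi> c) \<and>
    deficit a g \<bullet> mwu_step \<eta> (\<gamma> c) (\<xi> c) \<le> K * (deficit a g \<bullet> \<xi> c)"
    using ev \<xi>_in
  proof eventually_elim
    case (elim c)
    have step: "mwu_step \<eta> (\<gamma> c) (\<xi> c) $ j = \<rho> c j * \<xi> c $ j" for j
      by (simp add: mwu_step_def \<rho>_def)
    have w: "0 \<le> deficit a g $ j * \<xi> c $ j" for j
      using prob_simplexD(1)[OF elim(2)] by (simp add: deficit_def)
    have lo: "q * (deficit a g $ j * \<xi> c $ j) \<le> deficit a g $ j * (\<rho> c j * \<xi> c $ j)" for j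
    proof (cases "0 < deficit a g $ j")
      case True
      then have "q * (deficit a g $ j * \<xi> c $ j) \<le> \<rho> c j * (deficit a g $ j * \<xi> c $ j)"
        using elim(1) w[of j] by (intro mult_right_mono) (auto simp: less_imp_le)
      then show ?thesis by (simp add: algebra_simps)
    next
      case False
      then have "deficit a g $ j = 0" by (simp add: deficit_def)
      then show ?thesis by simp
    qed
    have hi: "deficit a g $ j * (\<rho> c j * \<xi> c $ j) \<le> K * (deficit a g $ j * \<xi> c $ j)" for j
    proof -
      have "\<rho> c j * (deficit a g $ j * \<xi> c $ j) \<le> K * (deficit a g $ j * \<xi> c $ j)"
        using elim(1) w[of j] by (intro mult_right_mono) (auto simp: less_imp_le)
      then show ?thesis by (simp add: algebra_simps)
    qed
    show ?case
      unfolding inner_vec_def step sum_distrib_left using lo hi by (auto intro!: sum_mono)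
  qed
  with q(1) show ?thesis by (rule that)
qed

section \<open>The saddle operator is monotone\<close>

text \<open>
  Along the segment from \<open>a\<close> in direction \<open>v\<close>, convexity bounds every difference quotient by the
  full increment, and the quotients converge to the derivative. Only a derivative within \<open>S\<close> is
  available, which suffices because the segment stays in \<open>S\<close>.
\<close>

lemma derivative_le_convex_increment:
  fixes h :: "'a :: real_normed_vector \<Rightarrow> real"
  assumes der: "(h has_derivative D) (at a within S)"
    and seg: "\<And>s. 0 \<le> s \<Longrightarrow> s \<le> 1 \<Longrightarrow> a + s *\<^sub>R v \<in> S"
    and cvx: "\<And>s. 0 \<le> s \<Longrightarrow> s \<le> 1 \<Longrightarrow> h (a + s *\<^sub>R v) \<le> (1 - s) * h a + s * h (a + v)"
  shows "D v \<le> h (a + v) - h a"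
proof -
  define \<phi> where "\<phi> s = h (a + s *\<^sub>R v)" for s
  have "((\<lambda>s. a + s *\<^sub>R v) has_derivative (\<lambda>s. s *\<^sub>R v)) (at 0 within {0..1})"
    by (auto intro!: derivative_eq_intros)
  moreover have "(h has_derivative D) (at (a + 0 *\<^sub>R v) within (\<lambda>s. a + s *\<^sub>R v) ` {0..1})"
  proof -
    have "(\<lambda>s. a + s *\<^sub>R v) ` {0..1} \<subseteq> S" using seg by auto
    from has_derivative_subset[OF der this] show ?thesis by simp
  qed
  ultimately have "(\<phi> has_derivative (\<lambda>s. D (s *\<^sub>R v))) (at 0 within {0..1})"
    unfolding \<phi>_def by (rule has_derivative_in_compose)
  then have "(\<phi> has_field_derivative D v) (at 0 within {0..1})"
    using linear_scale[OF has_derivative_linear[OF der]]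
    by (simp add: has_field_derivative_def mult.commute[of _ "D v"])
  then have lim: "((\<lambda>s. (\<phi> s - \<phi> 0) / (s - 0)) \<longlongrightarrow> D v) (at_right 0)"
    unfolding has_field_derivative_iff by (simp add: at_within_Icc_at_right)
  have "(\<phi> s - \<phi> 0) / (s - 0) \<le> h (a + v) - h a" if "0 < s" "s < 1" for s
  proof -
    have "\<phi> s - \<phi> 0 \<le> (h (a + v) - h a) * s"
      using cvx[of s] that by (simp add: \<phi>_def algebra_simps)
    then show ?thesis using that by (simp add: pos_divide_le_eq)
  qed
  then have "\<forall>\<^sub>F s in at_right 0. (\<phi> s - \<phi> 0) / (s - 0) \<le> h (a + v) - h a"
    unfolding eventually_at_right[OF zero_less_one] by (intro exI[of _ 1]) simp
  then show ?thesis
    by (rule tendsto_upperbound[OF lim]) simp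
qed

text \<open>
  The sum of the gradient inequality for the convex block and the one for the concave block. It
  yields both the monotonicity of the operator (by exchanging \<open>z\<close> and \<open>w\<close>) and the variational
  inequality satisfied by a saddle point \<open>w\<close>.
\<close>

lemma saddle_operator_gap:
  fixes f :: "(real ^ 'n) \<times> (real ^ 'm) \<Rightarrow> real"
  assumes grad: "gradient_field_on grad f strategies"
    and cvx: "\<And>y. y \<in> prob_simplex \<Longrightarrow> convex_on prob_simplex (\<lambda>x. f (x, y))"
    and ccv: "\<And>x. x \<in> prob_simplex \<Longrightarrow> concave_on prob_simplex (\<lambda>y. f (x, y))"
    and z: "z \<in> strategies" and w: "w \<in> strategies"
  shows "f (fst z, snd w) - f (fst w, snd z) \<le> saddle_operator grad z \<bullet> (z - w)"
proof -
  obtain x y u v where zw: "z = (x, y)" "w = (u, v)" by (cases z, cases w)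
  have mem: "x \<in> prob_simplex" "y \<in> prob_simplex" "u \<in> prob_simplex" "v \<in> prob_simplex"
    using z w by (auto simp: zw strategies_def)
  have der: "(f has_derivative (\<lambda>h. grad (x, y) \<bullet> h)) (at (x, y) within strategies)"
    using grad z unfolding gradient_field_on_def zw by blast
  have seg: "a + s *\<^sub>R (b - a) = (1 - s) *\<^sub>R a + s *\<^sub>R b" for s and a b :: "'z :: real_vector"
    by (simp add: algebra_simps)
  have "grad (x, y) \<bullet> (u - x, 0) \<le> f ((x, y) + (u - x, 0)) - f (x, y)"
  proof (rule derivative_le_convex_increment[OF der])
    fix s :: real assume s: "0 \<le> s" "s \<le> 1"
    have eq: "(x, y) + s *\<^sub>R (u - x, 0) = ((1 - s) *\<^sub>R x + s *\<^sub>R u, y)"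
      by (simp add: seg)
    show "(x, y) + s *\<^sub>R (u - x, 0) \<in> strategies"
      unfolding eq strategies_def using convexD_alt[OF convex_prob_simplex mem(1,3) s] mem(2) by simp
    show "f ((x, y) + s *\<^sub>R (u - x, 0)) \<le> (1 - s) * f (x, y) + s * f ((x, y) + (u - x, 0))"
      unfolding eq using convex_onD[OF cvx[OF mem(2)] s mem(1,3)] by simp
  qed
  moreover have "- (grad (x, y) \<bullet> (0, v - y)) \<le> - f ((x, y) + (0, v - y)) - - f (x, y)"
  proof (rule derivative_le_convex_increment[OF has_derivative_minus[OF der]])
    fix s :: real assume s: "0 \<le> s" "s \<le> 1"
    have eq: "(x, y) + s *\<^sub>R (0, v - y) = (x, (1 - s) *\<^sub>R y + s *\<^sub>R v)"
      by (simp add: seg)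
    show "(x, y) + s *\<^sub>R (0, v - y) \<in> strategies"
      unfolding eq strategies_def using convexD_alt[OF convex_prob_simplex mem(2,4) s] mem(1) by simp
    show "- f ((x, y) + s *\<^sub>R (0, v - y)) \<le> (1 - s) * - f (x, y) + s * - f ((x, y) + (0, v - y))"
      unfolding eq using convex_onD[OF ccv[OF mem(1), unfolded concave_on_def] s mem(2,4)] by simp
  qed
  ultimately show ?thesis
    by (simp add: zw saddle_operator_def inner_prod_def inner_diff_right)
qed

section \<open>Relative entropy of strategy pairs\<close>

definition pos_strategies :: "((real ^ 'n) \<times> (real ^ 'm)) set" where
  "pos_strategies = pos_simplex \<times> pos_simplex"

lemma pos_strategies_subset: "pos_strategies \<subseteq> strategies"
  by (auto simp: pos_strategies_def strategies_def pos_simplex_def)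

lemma closed_strategies: "closed (strategies :: ((real ^ 'n) \<times> (real ^ 'm)) set)"
  unfolding strategies_def by (intro closed_Times closed_prob_simplex)

lemma rel_interior_strategies:
  "rel_interior (strategies :: ((real ^ 'n) \<times> (real ^ 'm)) set) \<subseteq> pos_strategies"
proof -
  have "rel_interior (strategies :: ((real ^ 'n) \<times> (real ^ 'm)) set)
      = rel_interior prob_simplex \<times> rel_interior prob_simplex"
    unfolding strategies_def by (rule rel_interior_Times[OF convex_prob_simplex convex_prob_simplex])
  also have "\<dots> \<subseteq> pos_strategies"
    unfolding pos_strategies_def by (rule Sigma_mono[OF rel_interior_prob_simplex rel_interior_prob_simplex])
  finally show ?thesis .
qed

lemma mwu_step_pair_pos_strategies:
  "z \<in> pos_strategies \<Longrightarrow> mwu_step_pair \<eta> g z \<in> pos_strategies"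
  by (auto simp: pos_strategies_def mwu_step_pair_def mwu_step_pos_simplex)

definition strategy_entropy ::
  "(real ^ 'n) \<times> (real ^ 'm) \<Rightarrow> (real ^ 'n) \<times> (real ^ 'm) \<Rightarrow> real" where
  "strategy_entropy u v = relative_entropy (fst u) (fst v) + relative_entropy (snd u) (snd v)"

lemma strategy_pinsker:
  assumes "u \<in> strategies" "v \<in> pos_strategies"
  shows "(strategy_norm (u - v))\<^sup>2 \<le> 2 * strategy_entropy u v"
  using assms pinsker[of "fst u" "fst v"] pinsker[of "snd u" "snd v"]
  by (auto simp: strategies_def pos_strategies_def strategy_norm_def strategy_entropy_def)

lemma strategy_entropy_nonneg:
  assumes "u \<in> strategies" "v \<in> pos_strategies"
  shows "0 \<le> strategy_entropy u v"
  using strategy_pinsker[OF assms] zero_le_power2[of "strategy_norm (u - v)"] by linarith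

lemma strategy_three_point:
  assumes "v \<in> pos_strategies" "u \<in> strategies"
  shows "\<eta> * (g \<bullet> (mwu_step_pair \<eta> g v - u)) =
    strategy_entropy u v - strategy_entropy u (mwu_step_pair \<eta> g v)
      - strategy_entropy (mwu_step_pair \<eta> g v) v"
  using assms mwu_three_point[of "fst v" "fst u" \<eta> "fst g"] mwu_three_point[of "snd v" "snd u" \<eta> "snd g"]
  by (auto simp: pos_strategies_def strategies_def strategy_entropy_def mwu_step_pair_def
      inner_prod_def distrib_left)

lemma strategy_entropy_tendsto_0:
  assumes "u \<in> strategies" "(v \<longlongrightarrow> u) F"
  shows "((\<lambda>t. strategy_entropy u (v t)) \<longlongrightarrow> 0) F"
proof -
  have u: "fst u \<in> prob_simplex" "snd u \<in> prob_simplex" using assms(1) by (auto simp: strategies_def)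
  show ?thesis
    unfolding strategy_entropy_def
    using tendsto_add[OF relative_entropy_tendsto_0[OF u(1) tendsto_fst[OF assms(2)]]
        relative_entropy_tendsto_0[OF u(2) tendsto_snd[OF assms(2)]]] by simp
qed

section \<open>A trapping argument\<close>

text \<open>
  The dynamics near the cluster point, reduced to two sequences: the energy \<open>\<Phi>\<close>, which measures
  closeness and becomes arbitrarily small again and again, and the positive mass \<open>M\<close> of the
  deficient coordinates. While \<open>\<Phi> t < \<epsilon>\<close>, growth turns the allowed energy rise \<open>C * M t\<close> into at
  most \<open>C / (q - 1)\<close> times the increment of \<open>M\<close>, so \<open>\<Phi> t - C / (q - 1) * M t\<close> does not increase.
  Growth also bounds \<open>M t\<close> by its increment over \<open>q - 1\<close>, which is eventually tiny. Hence a late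
  time with \<open>\<Phi> t0 < \<epsilon> / 2\<close> starts a stay below \<open>\<epsilon>\<close> that never ends; but then \<open>M\<close> does not
  decrease any more and its increments stay at least \<open>(q - 1) * M t0\<close>.
\<close>

lemma unstable_mass_contradiction:
  fixes \<Phi> M :: "nat \<Rightarrow> real"
  assumes eps: "0 < \<epsilon>" and q: "1 < q" and C: "0 \<le> C"
    and pos: "\<And>t. 0 < M t"
    and inc: "(\<lambda>t. M (Suc t) - M t) \<longlonglongrightarrow> 0"
    and return: "\<And>\<delta> T. 0 < \<delta> \<Longrightarrow> \<exists>t\<ge>T. \<Phi> t < \<delta>"
    and growth: "\<forall>\<^sub>F t in sequentially. \<Phi> t < \<epsilon> \<longrightarrow> q * M t \<le> M (Suc t)"
    and drift: "\<forall>\<^sub>F t in sequentially. \<Phi> t < \<epsilon> \<longrightarrow> \<Phi> (Suc t) \<le> \<Phi> t + C * M t"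
  shows False
proof -
  define C' where "C' = C / (q - 1)"
  have C': "0 \<le> C'" "C = C' * (q - 1)" using q C by (auto simp: C'_def)
  define \<kappa> where "\<kappa> = C' * (1 / (q - 1) + 1) + 1"
  \<comment> \<open>\<open>\<mu>\<close> bounds the late increments of \<open>M\<close>. It is chosen so that \<open>C'\<close> times the resulting bound
    \<open>\<mu> / (q - 1) + \<mu>\<close> on \<open>M (Suc t)\<close> is less than \<open>\<epsilon> / 2\<close>.\<close>
  define \<mu> where "\<mu> = \<epsilon> / (2 * \<kappa>)"
  have \<kappa>: "0 < \<kappa>"
    unfolding \<kappa>_def using q C' by (intro add_nonneg_pos mult_nonneg_nonneg) auto
  then have \<mu>: "0 < \<mu>" "\<kappa> * \<mu> = \<epsilon> / 2" using eps by (auto simp: \<mu>_def)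
  have "\<forall>\<^sub>F t in sequentially. M (Suc t) - M t < \<mu> \<and>
      (\<Phi> t < \<epsilon> \<longrightarrow> q * M t \<le> M (Suc t)) \<and> (\<Phi> t < \<epsilon> \<longrightarrow> \<Phi> (Suc t) \<le> \<Phi> t + C * M t)"
    using order_tendstoD(2)[OF inc \<mu>(1)] growth drift by eventually_elim simp
  then obtain T where T: "\<And>t. t \<ge> T \<Longrightarrow> M (Suc t) - M t < \<mu>"
    "\<And>t. t \<ge> T \<Longrightarrow> \<Phi> t < \<epsilon> \<Longrightarrow> q * M t \<le> M (Suc t)"
    "\<And>t. t \<ge> T \<Longrightarrow> \<Phi> t < \<epsilon> \<Longrightarrow> \<Phi> (Suc t) \<le> \<Phi> t + C * M t"
    unfolding eventually_sequentially by blast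
  obtain t0 where t0: "t0 \<ge> T" "\<Phi> t0 < \<epsilon> / 2" using return[of "\<epsilon> / 2" T] eps by auto
  have inv: "\<Phi> t < \<epsilon> \<and> \<Phi> t - C' * M t \<le> \<Phi> t0" if "t \<ge> t0" for t
    using that
  proof (induction t rule: dec_induct)
    case base
    have "0 \<le> C' * M t0" using C' pos[of t0] by simp
    then show ?case using t0 eps by simp
  next
    case (step t)
    have t: "t \<ge> T" using step.hyps t0 by simp
    have grow: "(q - 1) * M t \<le> M (Suc t) - M t"
      using T(2)[OF t] step.IH by (simp add: algebra_simps)
    have "C * M t = C' * ((q - 1) * M t)" using C'(2) by simp
    also have "\<dots> \<le> C' * (M (Suc t) - M t)" by (rule mult_left_mono[OF grow C'(1)])
    finally have "\<Phi> (Suc t) \<le> \<Phi> t + C' * (M (Suc t) - M t)"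
      using T(3)[OF t] step.IH by linarith
    then have V: "\<Phi> (Suc t) - C' * M (Suc t) \<le> \<Phi> t0"
      using step.IH by (simp add: right_diff_distrib)
    have "(q - 1) * M t \<le> \<mu>" using grow T(1)[OF t] by linarith
    then have "M t \<le> \<mu> * (1 / (q - 1))" using q by (simp add: field_simps)
    then have "M (Suc t) \<le> \<mu> * (1 / (q - 1) + 1)"
      using T(1)[OF t] by (simp add: distrib_left)
    then have "C' * M (Suc t) \<le> C' * (\<mu> * (1 / (q - 1) + 1))" by (rule mult_left_mono[OF _ C'(1)])
    also have "\<dots> = \<kappa> * \<mu> - \<mu>" by (simp add: \<kappa>_def algebra_simps)
    finally have "\<Phi> (Suc t) < \<epsilon>" using V t0(2) \<mu> by linarith
    with V show ?case by simp
  qed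
  have grow: "(q - 1) * M t \<le> M (Suc t) - M t" if "t \<ge> t0" for t
    using T(2)[of t] inv[OF that] that t0(1) by (simp add: algebra_simps)
  have mono: "M t0 \<le> M t" if "t \<ge> t0" for t
    using that
  proof (induction t rule: dec_induct)
    case (step t)
    have "0 \<le> (q - 1) * M t" using q pos[of t] by simp
    then show ?case using grow[OF step.hyps(1)] step.IH by linarith
  qed simp
  have "(q - 1) * M t0 \<le> M (Suc t) - M t" if "t \<ge> t0" for t
    using grow[OF that] mult_left_mono[OF mono[OF that], of "q - 1"] q by linarith
  then have "(q - 1) * M t0 \<le> 0"
    by (intro tendsto_lowerbound[OF inc]) (auto simp: eventually_sequentially)
  then show False using q pos[of t0] by (simp add: mult_le_0_iff)
qed

section \<open>Optimistic multiplicative weights for monotone operators\<close>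

text \<open>
  The saddle problem enters through three properties of its operator: monotonicity, the Lipschitz
  bound, and a weak (Minty) solution of the variational inequality, which a saddle point provides.
\<close>

locale monotone_omwu =
  fixes G :: "(real ^ 'n) \<times> (real ^ 'm) \<Rightarrow> (real ^ 'n) \<times> (real ^ 'm)"
    and L \<eta> :: real and z z' :: "nat \<Rightarrow> (real ^ 'n) \<times> (real ^ 'm)"
  assumes monotone: "\<And>u v. u \<in> strategies \<Longrightarrow> v \<in> strategies \<Longrightarrow> 0 \<le> (G u - G v) \<bullet> (u - v)"
    and minty: "\<exists>u\<in>strategies. \<forall>v\<in>strategies. 0 \<le> G v \<bullet> (v - u)"
    and lipschitz: "lipschitz_operator L G"
    and eta: "0 < \<eta>" "\<eta> < 1 / (3 * L)"
    and alg: "omwu \<eta> G z z'"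
begin

lemma L_pos: "0 < L"
proof (rule ccontr)
  assume "\<not> 0 < L"
  then have "1 / (3 * L) \<le> 0" by (simp add: divide_nonneg_nonpos)
  with eta show False by linarith
qed

lemma eta_L: "0 < \<eta> * L" "3 * (\<eta> * L) < 1"
  using eta L_pos by (simp_all add: field_simps)

lemma step: "z (Suc t) = mwu_step_pair \<eta> (G (z' t)) (z t)"
  and step': "z' (Suc t) = mwu_step_pair \<eta> (G (z' t)) (z (Suc t))"
  using alg by (auto simp: omwu_def)

lemma z_pos: "z t \<in> pos_strategies"
proof (induction t)
  case 0
  show ?case using alg rel_interior_strategies by (auto simp: omwu_def)
next
  case (Suc t)
  then show ?case by (simp add: step mwu_step_pair_pos_strategies)
qed

lemma z'_pos: "z' t \<in> pos_strategies"
proof (cases t)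
  case 0
  show ?thesis using alg rel_interior_strategies 0 by (auto simp: omwu_def)
next
  case (Suc s)
  then show ?thesis by (simp add: step' mwu_step_pair_pos_strategies z_pos)
qed

lemma z_in: "z t \<in> strategies" and z'_in: "z' t \<in> strategies"
  by (rule subsetD[OF pos_strategies_subset z_pos], rule subsetD[OF pos_strategies_subset z'_pos])

text \<open>
  The index is shifted by one because \<open>z' 0\<close> is an arbitrary starting point: from time \<open>1\<close> on, the
  prediction \<open>z'\<close> is a step from the current iterate along the previous operator value. The
  coefficient of the squared gap is what the Lipschitz bound of the next step consumes.
\<close>

definition energy :: "(real ^ 'n) \<times> (real ^ 'm) \<Rightarrow> nat \<Rightarrow> real" where
  "energy u t = strategy_entropy u (z (Suc t)) + \<eta> * L / 2 * (strategy_norm (z (Suc t) - z' t))\<^sup>2"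

lemma strategy_norm_le_energy:
  assumes "u \<in> strategies"
  shows "(strategy_norm (u - z (Suc t)))\<^sup>2 \<le> 2 * energy u t"
proof -
  have "0 \<le> \<eta> * L / 2 * (strategy_norm (z (Suc t) - z' t))\<^sup>2" using eta_L by simp
  then show ?thesis
    using strategy_pinsker[OF assms z_pos[of "Suc t"]] by (simp add: energy_def)
qed

text \<open>
  Two three-point identities start from \<open>z (Suc t)\<close>: the one for the step to \<open>z (Suc (Suc t))\<close> compared
  with \<open>u\<close>, and the one for the step to \<open>z' (Suc t)\<close> compared with \<open>z (Suc (Suc t))\<close>. Their sum leaves
  an error term with the difference of the operator at the two latest predictions. Its Lipschitz
  bound costs \<open>\<eta> * L\<close> times half of two squared gaps plus one full squared gap, while Pinsker's
  inequality supplies half of each new squared gap; the old gap is paid by the energy itself.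
\<close>

lemma energy_descent:
  assumes u: "u \<in> strategies"
  shows "energy u (Suc t) + (1 - 3 * (\<eta> * L)) / 2 *
      ((strategy_norm (z' (Suc t) - z (Suc t)))\<^sup>2 + (strategy_norm (z (Suc (Suc t)) - z' (Suc t)))\<^sup>2)
    \<le> energy u t - \<eta> * (G (z' (Suc t)) \<bullet> (z' (Suc t) - u))"
proof -
  define z0' z1 z1' z2 where "z0' = z' t" "z1 = z (Suc t)" "z1' = z' (Suc t)" "z2 = z (Suc (Suc t))"
  note names = this
  have mem: "z1 \<in> pos_strategies" "z1' \<in> pos_strategies" "z2 \<in> strategies" "z1' \<in> strategies"
      "z0' \<in> strategies"
    by (simp_all add: names z_pos z'_pos z_in z'_in)
  \<comment> \<open>\<open>b\<close> is the old gap, contained in the energy at \<open>t\<close>; \<open>a\<close> and \<open>c\<close> are the two new gaps.\<close>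
  define a b c where "a = strategy_norm (z1' - z1)" "b = strategy_norm (z1 - z0')" "c = strategy_norm (z2 - z1')"
  note abc = this
  have "\<eta> * (G z1' \<bullet> (z2 - u)) = strategy_entropy u z1 - strategy_entropy u z2 - strategy_entropy z2 z1"
    using strategy_three_point[OF mem(1) u, of \<eta> "G z1'"] unfolding names by (simp add: step)
  moreover have "\<eta> * (G z0' \<bullet> (z1' - z2)) =
      strategy_entropy z2 z1 - strategy_entropy z2 z1' - strategy_entropy z1' z1"
    using strategy_three_point[OF mem(1) mem(3), of \<eta> "G z0'"] unfolding names by (simp add: step')
  moreover have "\<eta> * (G z1' \<bullet> (z1' - u)) =
      \<eta> * (G z1' \<bullet> (z2 - u)) + \<eta> * (G z0' \<bullet> (z1' - z2)) + \<eta> * ((G z1' - G z0') \<bullet> (z1' - z2))"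
    by (simp add: inner_diff_left inner_diff_right algebra_simps)
  moreover have "\<eta> * ((G z1' - G z0') \<bullet> (z1' - z2)) \<le> \<eta> * L * (a\<^sup>2 / 2 + b\<^sup>2 / 2 + c\<^sup>2)"
  proof -
    have ab: "strategy_norm (z1' - z0') \<le> a + b"
      using strategy_norm_triangle[of "z1' - z1" "z1 - z0'"] by (simp add: abc)
    have "(G z1' - G z0') \<bullet> (z1' - z2) \<le> dual_strategy_norm (G z1' - G z0') * c"
      using inner_le_dual_strategy_norm[of "G z1' - G z0'" "z1' - z2"]
      by (simp add: abc strategy_norm_minus_commute[of z2])
    also have "\<dots> \<le> (L * strategy_norm (z1' - z0')) * c"
      using lipschitz mem unfolding lipschitz_operator_def
      by (intro mult_right_mono) (simp_all add: abc strategy_norm_nonneg)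
    also have "\<dots> \<le> (L * (a + b)) * c"
      using ab L_pos by (intro mult_right_mono mult_left_mono) (simp_all add: abc strategy_norm_nonneg)
    also have "\<dots> \<le> L * (a\<^sup>2 / 2 + b\<^sup>2 / 2 + c\<^sup>2)"
    proof -
      have "0 \<le> (a - c)\<^sup>2 + (b - c)\<^sup>2" by simp
      then have "(a + b) * c \<le> a\<^sup>2 / 2 + b\<^sup>2 / 2 + c\<^sup>2" by (simp add: power2_eq_square algebra_simps)
      then show ?thesis using L_pos by (simp add: mult.assoc)
    qed
    finally show ?thesis using eta(1) by (simp add: mult.assoc)
  qed
  moreover have "c\<^sup>2 \<le> 2 * strategy_entropy z2 z1'" "a\<^sup>2 \<le> 2 * strategy_entropy z1' z1"
    unfolding abc by (rule strategy_pinsker[OF mem(3,2)], rule strategy_pinsker[OF mem(4,1)])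
  moreover have "0 \<le> \<eta> * L * a\<^sup>2" using eta_L by simp
  ultimately have "strategy_entropy u z2 + \<eta> * L / 2 * c\<^sup>2 + (1 - 3 * (\<eta> * L)) / 2 * (a\<^sup>2 + c\<^sup>2)
      \<le> strategy_entropy u z1 + \<eta> * L / 2 * b\<^sup>2 - \<eta> * (G z1' \<bullet> (z1' - u))"
    by (simp add: algebra_simps add_divide_distrib diff_divide_distrib)
  then show ?thesis unfolding energy_def abc names by simp
qed

text \<open>
  For a solution of the variational inequality the energy is nonincreasing and nonnegative, so its
  decrements tend to zero, and they dominate the squared gaps.
\<close>

lemma gaps_tendsto_0:
  "(\<lambda>t. z' (Suc t) - z (Suc t)) \<longlonglongrightarrow> 0" (is ?A) "(\<lambda>t. z (Suc t) - z' t) \<longlonglongrightarrow> 0" (is ?B)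
proof -
  obtain u where u: "u \<in> strategies" "\<And>v. v \<in> strategies \<Longrightarrow> 0 \<le> G v \<bullet> (v - u)"
    using minty by blast
  define \<kappa> where "\<kappa> = (1 - 3 * (\<eta> * L)) / 2"
  have \<kappa>: "0 < \<kappa>" using eta_L by (simp add: \<kappa>_def)
  define a where "a t = strategy_norm (z' (Suc t) - z (Suc t))" for t
  define c where "c t = strategy_norm (z (Suc (Suc t)) - z' (Suc t))" for t
  have step: "\<kappa> * ((a t)\<^sup>2 + (c t)\<^sup>2) \<le> energy u t - energy u (Suc t)" for t
  proof -
    have "0 \<le> \<eta> * (G (z' (Suc t)) \<bullet> (z' (Suc t) - u))" using eta(1) u(2)[OF z'_in] by simp
    then show ?thesis
      using energy_descent[OF u(1), of t] unfolding \<kappa>_def[symmetric] a_def c_def by linarith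
  qed
  have nonneg: "0 \<le> \<kappa> * ((a t)\<^sup>2 + (c t)\<^sup>2)" for t using \<kappa> by simp
  have "0 \<le> energy u t" for t
    using strategy_norm_le_energy[OF u(1), of t] zero_le_power2[of "strategy_norm (u - z (Suc t))"] by linarith
  moreover have "decseq (energy u)"
    using step nonneg by (intro decseq_SucI) (smt (verit))
  ultimately obtain l where l: "energy u \<longlonglongrightarrow> l" using decseq_convergent by blast
  have "(\<lambda>t. energy u t - energy u (Suc t)) \<longlonglongrightarrow> l - l"
    by (intro tendsto_diff l LIMSEQ_Suc)
  then have diff: "(\<lambda>t. (energy u t - energy u (Suc t)) / \<kappa>) \<longlonglongrightarrow> 0"
    by (simp add: tendsto_divide_zero)
  have bound: "v \<longlonglongrightarrow> 0"
    if v: "\<And>t. (strategy_norm (v t))\<^sup>2 \<le> (a t)\<^sup>2 + (c t)\<^sup>2" for v :: "nat \<Rightarrow> (real ^ 'n) \<times> (real ^ 'm)"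
  proof -
    have "norm ((norm (v t))\<^sup>2) \<le> (energy u t - energy u (Suc t)) / \<kappa>" for t
    proof -
      have "(norm (v t))\<^sup>2 \<le> (strategy_norm (v t))\<^sup>2"
        by (rule power_mono[OF norm_le_strategy_norm norm_ge_zero])
      also have "\<dots> \<le> (energy u t - energy u (Suc t)) / \<kappa>"
        using v[of t] step[of t] \<kappa> by (simp add: pos_le_divide_eq mult.commute)
           (smt (verit) mult_left_mono)
      finally show ?thesis by simp
    qed
    then have "(\<lambda>t. (norm (v t))\<^sup>2) \<longlonglongrightarrow> 0"
      by (intro Lim_null_comparison[OF _ diff] always_eventually) simp
    then show ?thesis by (simp add: tendsto_norm_zero_iff)
  qed
  show ?A
    by (rule bound) (simp add: a_def)
  have "(\<lambda>t. z (Suc (Suc t)) - z' (Suc t)) \<longlonglongrightarrow> 0"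
    by (rule bound) (simp add: c_def)
  then show ?B by (rule LIMSEQ_imp_Suc)
qed

text \<open>
  Since the gaps vanish, the iterates and predictions next to a subsequence converging to \<open>c\<close>
  converge to \<open>c\<close> as well. The indices are shifted so that a predecessor always exists.
\<close>

lemma cluster_sequence:
  assumes "cluster_point z c"
  obtains s where "filterlim s at_top sequentially"
    and "(\<lambda>k. z (Suc (s k))) \<longlonglongrightarrow> c" "(\<lambda>k. z' (Suc (s k))) \<longlonglongrightarrow> c"
    and "(\<lambda>k. z (Suc (Suc (s k)))) \<longlonglongrightarrow> c" "(\<lambda>k. z (Suc (s k)) - z' (s k)) \<longlonglongrightarrow> 0"
proof -
  obtain r where r: "strict_mono r" "(z \<circ> r) \<longlonglongrightarrow> c" using assms unfolding cluster_point_def by blast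
  define s where "s k = r (Suc k) - 1" for k
  have ge: "Suc k \<le> r (Suc k)" for k by (rule seq_suble[OF r(1)])
  have Suc_s: "Suc (s k) = r (Suc k)" for k using ge[of k] by (simp add: s_def)
  have "k \<le> s k" for k using ge[of k] by (simp add: s_def)
  then have top: "filterlim s at_top sequentially"
    by (intro filterlim_at_top_mono[OF filterlim_ident]) simp
  have z1: "(\<lambda>k. z (Suc (s k))) \<longlonglongrightarrow> c"
    unfolding Suc_s using LIMSEQ_Suc[OF r(2)] by simp
  have z1': "(\<lambda>k. z' (Suc (s k))) \<longlonglongrightarrow> c"
    using tendsto_add[OF filterlim_compose[OF gaps_tendsto_0(1) top] z1] by simp
  have gap2: "(\<lambda>k. z (Suc (Suc (s k))) - z' (Suc (s k))) \<longlonglongrightarrow> 0"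
    by (rule filterlim_compose[OF LIMSEQ_Suc[OF gaps_tendsto_0(2)] top])
  have z2: "(\<lambda>k. z (Suc (Suc (s k)))) \<longlonglongrightarrow> c"
    using tendsto_add[OF gap2 z1'] by simp
  show ?thesis
    by (rule that[OF top z1 z1' z2 filterlim_compose[OF gaps_tendsto_0(2) top]])
qed

lemma cluster_point_in_strategies:
  assumes "cluster_point z c"
  shows "c \<in> strategies"
proof -
  obtain s where "(\<lambda>k. z (Suc (s k))) \<longlonglongrightarrow> c" using cluster_sequence[OF assms] by blast
  then show ?thesis
    by (rule closed_sequentially[OF closed_strategies z_in])
qed

lemma cluster_point_fixed:
  assumes "cluster_point z c"
  shows "mwu_step_pair \<eta> (G c) c = c"
proof -
  obtain s where "filterlim s at_top sequentially"
    and s: "(\<lambda>k. z (Suc (s k))) \<longlonglongrightarrow> c" "(\<lambda>k. z' (Suc (s k))) \<longlonglongrightarrow> c"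
      "(\<lambda>k. z (Suc (Suc (s k)))) \<longlonglongrightarrow> c" and "(\<lambda>k. z (Suc (s k)) - z' (s k)) \<longlonglongrightarrow> 0"
    by (rule cluster_sequence[OF assms])
  have c: "c \<in> strategies" by (rule cluster_point_in_strategies[OF assms])
  have "(\<lambda>k. G (z' (Suc (s k)))) \<longlonglongrightarrow> G c"
    using continuous_on_tendsto_compose[OF lipschitz_operator_continuous_on[OF lipschitz] s(2) c]
    by (simp add: z'_in)
  then have "(\<lambda>k. mwu_step_pair \<eta> (G (z' (Suc (s k)))) (z (Suc (s k)))) \<longlonglongrightarrow> mwu_step_pair \<eta> (G c) c"
    unfolding mwu_step_pair_def using c s(1)
    by (intro tendsto_Pair mwu_step_tendsto tendsto_fst tendsto_snd) (auto simp: strategies_def)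
  then show ?thesis
    unfolding step[symmetric] using LIMSEQ_unique[OF _ s(3)] by blast
qed

lemma energy_returns:
  assumes c: "cluster_point z c" and "0 < \<delta>"
  shows "\<exists>t\<ge>T. energy c t < \<delta>"
proof -
  obtain s where s: "filterlim s at_top sequentially" "(\<lambda>k. z (Suc (s k))) \<longlonglongrightarrow> c"
    and "(\<lambda>k. z' (Suc (s k))) \<longlonglongrightarrow> c" "(\<lambda>k. z (Suc (Suc (s k)))) \<longlonglongrightarrow> c"
    and s': "(\<lambda>k. z (Suc (s k)) - z' (s k)) \<longlonglongrightarrow> 0"
    by (rule cluster_sequence[OF c])
  have "(\<lambda>k. energy c (s k)) \<longlonglongrightarrow> 0 + \<eta> * L / 2 * 0\<^sup>2"
    unfolding energy_def
    by (rule tendsto_add[OF strategy_entropy_tendsto_0[OF cluster_point_in_strategies[OF c] s(2)]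
        tendsto_mult_left[OF tendsto_power[OF strategy_norm_tendsto_0[OF s']]]])
  then have "\<forall>\<^sub>F k in sequentially. energy c (s k) < \<delta>"
    using assms(2) by (intro order_tendstoD(2)) simp_all
  moreover have "\<forall>\<^sub>F k in sequentially. T \<le> s k" using s(1) by (simp add: filterlim_at_top)
  ultimately have "\<forall>\<^sub>F k in sequentially. energy c (s k) < \<delta> \<and> T \<le> s k"
    by (rule eventually_conj)
  from eventually_happens'[OF sequentially_bot this]
  obtain k where "energy c (s k) < \<delta> \<and> T \<le> s k" ..
  then show ?thesis by (intro exI[of _ "s k"]) simp
qed

text \<open>
  The block estimates of \<open>mwu_deficit_growth\<close> hold near \<open>(c, c)\<close>, when the operator is evaluated
  at one nearby point and the step starts from another, as it does for the prediction and the
  iterate; the radius is common to both blocks.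
\<close>

lemma cluster_point_multipliers:
  assumes c: "c \<in> strategies"
    and a: "\<forall>i\<in>supp (fst c). fst (G c) $ i = a" and b: "\<forall>j\<in>supp (snd c). snd (G c) $ j = b"
  defines "W \<equiv> (deficit a (fst (G c)), deficit b (snd (G c)))"
  obtains q K \<delta> where "1 < q" "0 \<le> K" "0 < \<delta>"
    and "\<And>u v. u \<in> strategies \<Longrightarrow> v \<in> strategies \<Longrightarrow> dist u c < \<delta> \<Longrightarrow> dist v c < \<delta> \<Longrightarrow>
      q * (W \<bullet> v) \<le> W \<bullet> mwu_step_pair \<eta> (G u) v \<and> W \<bullet> mwu_step_pair \<eta> (G u) v \<le> K * (W \<bullet> v)"
proof -
  let ?F = "inf (nhds (c, c)) (principal (strategies \<times> strategies))"
  have ident: "((\<lambda>p. p) \<longlongrightarrow> (c, c)) ?F"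
    by (simp add: filterlim_def filtermap_ident)
  have in_F: "\<forall>\<^sub>F p in ?F. p \<in> strategies \<times> strategies"
    by (simp add: eventually_inf_principal)
  have "((\<lambda>p. G (fst p)) \<longlongrightarrow> G c) ?F"
  proof (rule continuous_on_tendsto_compose[OF lipschitz_operator_continuous_on[OF lipschitz] _ c])
    show "(fst \<longlongrightarrow> c) ?F" using tendsto_fst[OF ident] by simp
    show "\<forall>\<^sub>F p in ?F. fst p \<in> strategies" by (rule eventually_mono[OF in_F]) auto
  qed
  note G = tendsto_fst[OF this] tendsto_snd[OF this]
  have v: "((\<lambda>p. snd p) \<longlongrightarrow> c) ?F" using tendsto_snd[OF ident] by simp
  note V = tendsto_fst[OF v] tendsto_snd[OF v]
  have simplex: "\<forall>\<^sub>F p in ?F. fst (snd p) \<in> prob_simplex" "\<forall>\<^sub>F p in ?F. snd (snd p) \<in> prob_simplex"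
    unfolding eventually_inf_principal by (simp_all add: strategies_def mem_Times_iff)
  have c': "fst c \<in> prob_simplex" "snd c \<in> prob_simplex" using c by (auto simp: strategies_def)
  obtain q1 K1 where q1: "1 < q1" and
    ev1: "\<forall>\<^sub>F p in ?F. q1 * (fst W \<bullet> fst (snd p)) \<le> fst W \<bullet> mwu_step \<eta> (fst (G (fst p))) (fst (snd p)) \<and>
        fst W \<bullet> mwu_step \<eta> (fst (G (fst p))) (fst (snd p)) \<le> K1 * (fst W \<bullet> fst (snd p))"
    unfolding W_def fst_conv by (rule mwu_deficit_growth[OF eta(1) c'(1) a G(1) V(1) simplex(1)])
  obtain q2 K2 where q2: "1 < q2" and
    ev2: "\<forall>\<^sub>F p in ?F. q2 * (snd W \<bullet> snd (snd p)) \<le> snd W \<bullet> mwu_step \<eta> (snd (G (fst p))) (snd (snd p)) \<and>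
        snd W \<bullet> mwu_step \<eta> (snd (G (fst p))) (snd (snd p)) \<le> K2 * (snd W \<bullet> snd (snd p))"
    unfolding W_def snd_conv by (rule mwu_deficit_growth[OF eta(1) c'(2) b G(2) V(2) simplex(2)])
  define q where "q = min q1 q2"
  define K where "K = max 0 (max K1 K2)"
  define Q where "Q p \<longleftrightarrow> q * (W \<bullet> snd p) \<le> W \<bullet> mwu_step_pair \<eta> (G (fst p)) (snd p) \<and>
      W \<bullet> mwu_step_pair \<eta> (G (fst p)) (snd p) \<le> K * (W \<bullet> snd p)" for p
  have "\<forall>\<^sub>F p in ?F. Q p"
    using ev1 ev2 simplex
  proof eventually_elim
    case (elim p)
    have "0 \<le> fst W \<bullet> fst (snd p)" "0 \<le> snd W \<bullet> snd (snd p)"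
      using elim(3,4) by (simp_all add: W_def deficit_inner_nonneg)
    then have "q * (fst W \<bullet> fst (snd p)) \<le> q1 * (fst W \<bullet> fst (snd p))"
      "q * (snd W \<bullet> snd (snd p)) \<le> q2 * (snd W \<bullet> snd (snd p))"
      "K1 * (fst W \<bullet> fst (snd p)) \<le> K * (fst W \<bullet> fst (snd p))"
      "K2 * (snd W \<bullet> snd (snd p)) \<le> K * (snd W \<bullet> snd (snd p))"
      by (auto simp: q_def K_def intro!: mult_right_mono)
    then show ?case
      unfolding Q_def using elim(1,2) by (simp add: inner_prod_def mwu_step_pair_def distrib_left)
  qed
  then obtain d where d: "0 < d" "\<And>p. dist p (c, c) < d \<Longrightarrow> p \<in> strategies \<times> strategies \<Longrightarrow> Q p"
    unfolding eventually_inf_principal eventually_nhds_metric by blast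
  show ?thesis
  proof (rule that[of q K "d / 2"])
    fix u v assume uv: "u \<in> strategies" "v \<in> strategies" "dist u c < d / 2" "dist v c < d / 2"
    have "dist (u, v) (c, c) \<le> dist u c + dist v c"
      unfolding dist_Pair_Pair by (rule sqrt_sum_squares_le_sum) simp_all
    then have "dist (u, v) (c, c) < d" using uv by simp
    then have "Q (u, v)" by (rule d(2)) (simp add: uv)
    then show "q * (W \<bullet> v) \<le> W \<bullet> mwu_step_pair \<eta> (G u) v \<and>
        W \<bullet> mwu_step_pair \<eta> (G u) v \<le> K * (W \<bullet> v)"
      by (simp add: Q_def)
  qed (use q1 q2 d(1) in \<open>auto simp: q_def K_def\<close>)
qed

text \<open>
  A nonzero deficit vector \<open>W\<close> would satisfy all premises of \<open>unstable_mass_contradiction\<close>, with the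
  energy relative to the cluster point itself. Pinsker's inequality turns small energy into
  closeness to \<open>c\<close>, and the vanishing gaps carry closeness over to the predictions \<open>z' t\<close> and
  \<open>z' (Suc t)\<close>.
\<close>

theorem cluster_point_optimal:
  assumes cluster: "cluster_point z c"
    and a: "\<forall>i\<in>supp (fst c). fst (G c) $ i = a" and b: "\<forall>j\<in>supp (snd c). snd (G c) $ j = b"
  shows "a \<le> fst (G c) $ i" "b \<le> snd (G c) $ j"
proof -
  define W where "W = (deficit a (fst (G c)), deficit b (snd (G c)))"
  have c: "c \<in> strategies" by (rule cluster_point_in_strategies[OF cluster])
  have "W = 0"
  proof (rule ccontr)
    assume "W \<noteq> 0"
    define M where "M t = W \<bullet> z (Suc t)" for t
    have M_pos: "0 < M t" for t
    proof -
      have pos: "fst (z (Suc t)) \<in> pos_simplex" "snd (z (Suc t)) \<in> pos_simplex"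
        using z_pos[of "Suc t"] by (auto simp: pos_strategies_def)
      have "fst W \<noteq> 0 \<or> snd W \<noteq> 0" using \<open>W \<noteq> 0\<close> by (simp add: prod_eq_iff)
      moreover have "0 \<le> fst W \<bullet> fst (z (Suc t))" "0 \<le> snd W \<bullet> snd (z (Suc t))"
        using pos by (simp_all add: W_def deficit_inner_nonneg pos_simplex_def)
      ultimately show ?thesis
        using deficit_inner_pos[OF _ pos(1)] deficit_inner_pos[OF _ pos(2)]
        by (auto simp: M_def W_def inner_prod_def intro: add_pos_nonneg add_nonneg_pos)
    qed
    obtain q K \<delta> where q: "1 < q" and K: "0 \<le> K" and \<delta>: "0 < \<delta>" and
      mult: "\<And>u v. u \<in> strategies \<Longrightarrow> v \<in> strategies \<Longrightarrow> dist u c < \<delta> \<Longrightarrow> dist v c < \<delta> \<Longrightarrow>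
        q * (W \<bullet> v) \<le> W \<bullet> mwu_step_pair \<eta> (G u) v \<and> W \<bullet> mwu_step_pair \<eta> (G u) v \<le> K * (W \<bullet> v)"
      using cluster_point_multipliers[OF c a b] unfolding W_def by blast
    \<comment> \<open>Half of the radius \<open>\<delta>\<close> is left for the distance between iterate and prediction.\<close>
    define \<epsilon> where "\<epsilon> = (\<delta> / 2)\<^sup>2 / 2"
    have near: "dist (z (Suc t)) c < \<delta> / 2" if "energy c t < \<epsilon>" for t
    proof -
      have "(dist (z (Suc t)) c)\<^sup>2 \<le> (strategy_norm (c - z (Suc t)))\<^sup>2"
        by (rule power_mono) (simp_all add: dist_norm norm_minus_commute[of "z (Suc t)"] norm_le_strategy_norm)
      also have "\<dots> < (\<delta> / 2)\<^sup>2"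
        using strategy_norm_le_energy[OF c, of t] that by (simp add: \<epsilon>_def)
      finally show ?thesis by (rule power2_less_imp_less) (use \<delta> in simp)
    qed
    have close: "\<forall>\<^sub>F t in sequentially. norm (z' (Suc t) - z (Suc t)) < \<delta> / 2 \<and> norm (z (Suc t) - z' t) < \<delta> / 2"
      using gaps_tendsto_0[THEN tendsto_norm_zero, THEN order_tendstoD(2), of "\<delta> / 2"] \<delta>
      by (simp add: eventually_conj)
    have near': "dist (z (Suc t)) c < \<delta> \<and> dist (z' (Suc t)) c < \<delta> \<and> dist (z' t) c < \<delta>"
      if "energy c t < \<epsilon>" "norm (z' (Suc t) - z (Suc t)) < \<delta> / 2 \<and> norm (z (Suc t) - z' t) < \<delta> / 2" for t
      using near[OF that(1)] that(2) \<delta> dist_triangle[of "z' (Suc t)" c "z (Suc t)"]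
        dist_triangle[of "z' t" c "z (Suc t)"]
      by (simp add: dist_norm norm_minus_commute[of "z' t" "z (Suc t)"])
    show False
    proof (rule unstable_mass_contradiction[of \<epsilon> q "\<eta> * K" M "energy c"])
      show "(\<lambda>t. M (Suc t) - M t) \<longlonglongrightarrow> 0"
      proof -
        have "(\<lambda>t. W \<bullet> ((z (Suc (Suc t)) - z' (Suc t)) + (z' (Suc t) - z (Suc t)))) \<longlonglongrightarrow> W \<bullet> (0 + 0)"
          by (intro tendsto_intros LIMSEQ_Suc[OF gaps_tendsto_0(2)] gaps_tendsto_0(1))
        then show ?thesis by (simp add: M_def inner_diff_right)
      qed
      show "\<forall>\<^sub>F t in sequentially. energy c t < \<epsilon> \<longrightarrow> q * M t \<le> M (Suc t)"
        using close
      proof eventually_elim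
        case (elim t)
        show ?case
          using mult[OF z'_in[of "Suc t"] z_in[of "Suc t"]] near'[OF _ elim]
          unfolding M_def step[of "Suc t"] by blast
      qed
      show "\<forall>\<^sub>F t in sequentially. energy c t < \<epsilon> \<longrightarrow> energy c (Suc t) \<le> energy c t + \<eta> * K * M t"
        using close
      proof eventually_elim
        case (elim t)
        show ?case
        proof
          assume e: "energy c t < \<epsilon>"
          have z': "z' (Suc t) \<in> strategies" by (rule z'_in)
          have "W \<bullet> z' (Suc t) \<le> K * M t"
            using mult[OF z'_in[of t] z_in[of "Suc t"]] near'[OF e elim]
            unfolding M_def step'[of t] by blast
          moreover have "- (W \<bullet> z' (Suc t)) \<le> G c \<bullet> (z' (Suc t) - c)"
            using inner_ge_neg_deficit[OF _ _ a, of "fst (z' (Suc t))"]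
              inner_ge_neg_deficit[OF _ _ b, of "snd (z' (Suc t))"] c z'
            by (auto simp: W_def inner_prod_def strategies_def)
          moreover have "G c \<bullet> (z' (Suc t) - c) \<le> G (z' (Suc t)) \<bullet> (z' (Suc t) - c)"
            using monotone[OF z' c] by (simp add: inner_diff_left)
          ultimately have "- (\<eta> * (G (z' (Suc t)) \<bullet> (z' (Suc t) - c))) \<le> \<eta> * K * M t"
            using eta(1) mult_left_mono[of "- (G (z' (Suc t)) \<bullet> (z' (Suc t) - c))" "K * M t" \<eta>]
            by (simp add: mult.assoc)
          moreover have "0 \<le> (1 - 3 * (\<eta> * L)) / 2 *
            ((strategy_norm (z' (Suc t) - z (Suc t)))\<^sup>2 + (strategy_norm (z (Suc (Suc t)) - z' (Suc t)))\<^sup>2)"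
            using eta_L by simp
          ultimately show "energy c (Suc t) \<le> energy c t + \<eta> * K * M t"
            using energy_descent[OF c, of t] by linarith
        qed
      qed
      show "\<exists>t\<ge>T. energy c t < d" if "0 < d" for d T
        by (rule energy_returns[OF cluster that])
    qed (use M_pos q K eta \<delta> in \<open>auto simp: \<epsilon>_def\<close>)
  qed
  then have "deficit a (fst (G c)) $ i = 0" "deficit b (snd (G c)) $ j = 0"
    by (simp_all add: W_def prod_eq_iff)
  then show "a \<le> fst (G c) $ i" "b \<le> snd (G c) $ j" by (simp_all add: deficit_def max_def split: if_splits)
qed

end

section \<open>Saddle points\<close>

lemma monotone_omwu_saddle_operator:
  fixes f :: "(real ^ 'n) \<times> (real ^ 'm) \<Rightarrow> real"
  assumes grad: "gradient_field_on grad f strategies"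
    and cvx: "\<And>y. y \<in> prob_simplex \<Longrightarrow> convex_on prob_simplex (\<lambda>x. f (x, y))"
    and ccv: "\<And>x. x \<in> prob_simplex \<Longrightarrow> concave_on prob_simplex (\<lambda>y. f (x, y))"
    and saddle: "{zs. saddle_point f zs} \<noteq> {}"
    and lip: "lipschitz_operator L (saddle_operator grad)"
    and eta: "0 < \<eta>" "\<eta> < 1 / (3 * L)"
    and alg: "omwu \<eta> (saddle_operator grad) z z'"
  shows "monotone_omwu (saddle_operator grad) L \<eta> z z'"
proof
  have gap: "f (fst u, snd v) - f (fst v, snd u) \<le> saddle_operator grad u \<bullet> (u - v)"
    if "u \<in> strategies" "v \<in> strategies" for u v
    by (rule saddle_operator_gap; fact)
  show "0 \<le> (saddle_operator grad u - saddle_operator grad v) \<bullet> (u - v)"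
    if "u \<in> strategies" "v \<in> strategies" for u v
    using gap[OF that] gap[OF that(2,1)] by (simp add: inner_diff_left inner_diff_right)
  obtain s where s: "saddle_point f s" using saddle by blast
  have "0 \<le> saddle_operator grad v \<bullet> (v - s)" if v: "v \<in> strategies" for v
  proof -
    have "f (fst s, snd v) \<le> f s" "f s \<le> f (fst v, snd s)"
      using s v unfolding saddle_point_def by (auto simp: case_prod_beta)
    then show ?thesis using gap[OF v, of s] s by (simp add: saddle_point_def)
  qed
  then show "\<exists>u\<in>strategies. \<forall>v\<in>strategies. 0 \<le> saddle_operator grad v \<bullet> (v - u)"
    using s unfolding saddle_point_def by blast
qed (use lip eta alg in auto)

theorem lemma12:
  fixes f :: "(real ^ 'n) \<times> (real ^ 'm) \<Rightarrow> real"
    and grad :: "(real ^ 'n) \<times> (real ^ 'm) \<Rightarrow> (real ^ 'n) \<times> (real ^ 'm)"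
    and L \<eta> :: real
    and z z' :: "nat \<Rightarrow> (real ^ 'n) \<times> (real ^ 'm)"
    and xbar :: "real ^ 'n" and ybar :: "real ^ 'm"
  assumes grad: "gradient_field_on grad f strategies"
    and cvx: "\<And>y. y \<in> prob_simplex \<Longrightarrow> convex_on prob_simplex (\<lambda>x. f (x, y))"
    and ccv: "\<And>x. x \<in> prob_simplex \<Longrightarrow> concave_on prob_simplex (\<lambda>y. f (x, y))"
    and saddle: "{zs. saddle_point f zs} \<noteq> {}"
    and lip: "lipschitz_operator L (saddle_operator grad)"
    and eta: "0 < \<eta>" "\<eta> < 1 / (3 * L)"
    and alg: "omwu \<eta> (saddle_operator grad) z z'"
    and cluster: "cluster_point z (xbar, ybar)"
  shows "(\<exists>ax ay. active_face_constants grad (xbar, ybar) ax ay) \<and>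
    (\<forall>ax ay. active_face_constants grad (xbar, ybar) ax ay \<longrightarrow>
       (\<forall>i. i \<notin> supp xbar \<longrightarrow> fst (grad (xbar, ybar)) $ i \<ge> ax) \<and>
       (\<forall>j. j \<notin> supp ybar \<longrightarrow> - snd (grad (xbar, ybar)) $ j \<ge> ay))"
proof -
  interpret monotone_omwu "saddle_operator grad" L \<eta> z z'
    by (rule monotone_omwu_saddle_operator; fact)
  let ?c = "(xbar, ybar)"
  have fixed: "mwu_step \<eta> (fst (saddle_operator grad ?c)) xbar = xbar"
    "mwu_step \<eta> (snd (saddle_operator grad ?c)) ybar = ybar"
    using cluster_point_fixed[OF cluster] by (simp_all add: mwu_step_pair_def)
  have "\<exists>ax ay. active_face_constants grad ?c ax ay"
    using fixed[THEN mwu_fixed_point_active_constant[OF eta(1)]]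
    by (auto simp: active_face_constants_def saddle_operator_def)
  moreover have "ax \<le> fst (grad ?c) $ i \<and> ay \<le> - snd (grad ?c) $ j"
    if "active_face_constants grad ?c ax ay" for ax ay i j
    using cluster_point_optimal[OF cluster, of ax ay] that
    by (simp add: active_face_constants_def saddle_operator_def)
  ultimately show ?thesis by blast
qed

end
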